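(* Let $M\subset\mathbb{R}^3$ be a nontrivial concircular surface with associated concircular vector field $Y$. Then $M$ can be locally parametrized by $$X(t,z)=\beta(t)+z\,\big(\cos\varphi\,N_\beta(t)+\sin\varphi\,\eta(t)\big),$$ with $\varphi\in(0,\pi/2]$ a constant, $\beta$ being a curve in a totally umbilical surface $S\subset\mathbb{R}^3$ whose normal vector field $\eta$ is parallel to $Y$ along $S$.
   Context: A concircular vector field on $\mathbb{R}^3$ is a vector field $Y(p)=\mu p+v$ with constants $\mu\in\mathbb{R}$, $v\in\mathbb{R}^3$. A surface $M\subset\mathbb{R}^3$ with unit normal vector field $N$ is a concircular surface with axis (associated concircular vector field) $Y$ if $\langle N,Y\rangle$ is constant along $M$; it is nontrivial if it is not an open piece of a plane or a sphere. A totally umbilical surface $S$ is a plane or a sphere. For a unit speed curve $\beta$ in $S$, $\{T_\beta,N_\beta,\eta\}$ denotes its Darboux frame: $T_\beta=\beta'$, $\eta(t)$ is the unit normal of $S$ at $\beta(t)$, and $N_\beta(t)$ is the unit vector tangent to $S$ and orthogonal to $T_\beta(t)$ such that $\eta=T_\beta\times N_\beta$.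
   Formalization: M is taken connected and Y not identically zero, and the local parametrization is claimed around every point of M except those where M coincides nearby with a plane and Y is normal to M, at which the claim fails. *)

theory Defs
  imports "HOL-Analysis.Analysis"
begin

text \<open>\<open>Ck_on k f U\<close>: all iterated directional derivatives of \<open>f\<close> up to order \<open>k\<close> exist and are
  continuous. It is meant for open \<open>U\<close>; the derivatives are full Frechet derivatives at the points
  of \<open>U\<close>.\<close>

primrec Ck_on :: "nat \<Rightarrow> ('a::euclidean_space \<Rightarrow> 'b::real_normed_vector) \<Rightarrow> 'a set \<Rightarrow> bool" where
  "Ck_on 0 f U \<longleftrightarrow> continuous_on U f"
| "Ck_on (Suc k) f U \<longleftrightarrow>
     (\<forall>x\<in>U. f differentiable (at x)) \<and> (\<forall>v. Ck_on k (\<lambda>x. frechet_derivative f (at x) v) U)"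

definition smooth_on :: "'a::euclidean_space set \<Rightarrow> ('a \<Rightarrow> 'b::real_normed_vector) \<Rightarrow> bool" where
  "smooth_on U f \<longleftrightarrow> (\<forall>k. Ck_on k f U)"

definition local_parametrization ::
  "(real^3) set \<Rightarrow> (real \<times> real \<Rightarrow> real^3) \<Rightarrow> (real \<times> real) set \<Rightarrow> bool" where
  "local_parametrization M X D \<longleftrightarrow>
     open D \<and> smooth_on D X \<and> (\<forall>u\<in>D. inj (frechet_derivative X (at u))) \<and>
     openin (top_of_set M) (X ` D) \<and> (\<exists>G. homeomorphism D (X ` D) X G)"

definition regular_surface :: "(real^3) set \<Rightarrow> bool" where
  "regular_surface M \<longleftrightarrow> (\<forall>p\<in>M. \<exists>X D. local_parametrization M X D \<and> p \<in> X ` D)"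

definition tangent_space :: "(real^3) set \<Rightarrow> real^3 \<Rightarrow> (real^3) set" where
  "tangent_space M p =
     {w. \<exists>\<gamma> e. e > 0 \<and> smooth_on {-e<..<e} \<gamma> \<and> \<gamma> ` {-e<..<e} \<subseteq> M \<and> \<gamma> 0 = p \<and>
           (\<gamma> has_vector_derivative w) (at 0)}"

text \<open>On a smooth surface a continuous unit normal field is automatically smooth.\<close>

definition unit_normal_field :: "(real^3) set \<Rightarrow> (real^3 \<Rightarrow> real^3) \<Rightarrow> bool" where
  "unit_normal_field M N \<longleftrightarrow>
     continuous_on M N \<and> (\<forall>p\<in>M. norm (N p) = 1 \<and> (\<forall>w\<in>tangent_space M p. N p \<bullet> w = 0))"

definition is_plane :: "(real^3) set \<Rightarrow> bool" where
  "is_plane P \<longleftrightarrow> (\<exists>a b. a \<noteq> 0 \<and> P = {x. a \<bullet> x = b})"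

definition is_sphere :: "(real^3) set \<Rightarrow> bool" where
  "is_sphere S \<longleftrightarrow> (\<exists>c r. r > 0 \<and> S = sphere c r)"

definition totally_umbilical :: "(real^3) set \<Rightarrow> bool" where
  "totally_umbilical S \<longleftrightarrow> is_plane S \<or> is_sphere S"

definition concircular_field :: "(real^3 \<Rightarrow> real^3) \<Rightarrow> bool" where
  "concircular_field Y \<longleftrightarrow> (\<exists>\<mu> v. \<forall>p. Y p = \<mu> *\<^sub>R p + v)"

text \<open>Surfaces are connected, as usual. The zero field satisfies this definition on every orientable
  surface, so \<open>Y\<close> has to be assumed nonzero where the axis matters.\<close>

definition concircular_surface :: "(real^3) set \<Rightarrow> (real^3 \<Rightarrow> real^3) \<Rightarrow> bool" where
  "concircular_surface M Y \<longleftrightarrow>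
     regular_surface M \<and> connected M \<and> concircular_field Y \<and>
     (\<exists>N. unit_normal_field M N \<and> (\<lambda>p. N p \<bullet> Y p) constant_on M)"

definition nontrivial_surface :: "(real^3) set \<Rightarrow> bool" where
  "nontrivial_surface M \<longleftrightarrow>
     \<not> (\<exists>P. (is_plane P \<or> is_sphere P) \<and> openin (top_of_set P) M)"

text \<open>\<open>(T t, B t, \<eta> (\<beta> t))\<close> is the Darboux frame along the unit speed curve \<open>\<beta>\<close> in \<open>S\<close>, where \<open>\<eta>\<close> is a
  unit normal field of \<open>S\<close> and \<open>B\<close> is the field written \<open>N\<^sub>\<beta>\<close> in the literature.\<close>

definition darboux_frame ::
  "(real^3) set \<Rightarrow> (real^3 \<Rightarrow> real^3) \<Rightarrow> real set \<Rightarrow> (real \<Rightarrow> real^3) \<Rightarrow>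
     (real \<Rightarrow> real^3) \<Rightarrow> (real \<Rightarrow> real^3) \<Rightarrow> bool" where
  "darboux_frame S \<eta> I \<beta> T B \<longleftrightarrow>
     (\<forall>t\<in>I. \<beta> t \<in> S \<and> (\<beta> has_vector_derivative T t) (at t) \<and> norm (T t) = 1 \<and>
        norm (B t) = 1 \<and> B t \<in> tangent_space S (\<beta> t) \<and> B t \<bullet> T t = 0 \<and>
        \<eta> (\<beta> t) = cross3 (T t) (B t))"

text \<open>The local parametrizability claimed for a concircular surface can fail at a point of this kind,
  and a surface that is not globally a piece of a plane may contain one: near it, the plane is foliated
  by the integral rays of the tangential part of \<open>Y\<close>, all issuing from that point, where no ruled
  parametrization along them is regular. Take for instance \<open>Y p = p\<close> and a conical
  surface that contains a planar disc around the origin and an arm of that disc which bends away from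
  the disc's plane far from the origin.\<close>

definition planar_vertex :: "(real^3) set \<Rightarrow> (real^3 \<Rightarrow> real^3) \<Rightarrow> real^3 \<Rightarrow> bool" where
  "planar_vertex M Y p \<longleftrightarrow>
     (\<forall>w\<in>tangent_space M p. Y p \<bullet> w = 0) \<and>
     (\<exists>V P. open V \<and> p \<in> V \<and> is_plane P \<and> M \<inter> V \<subseteq> P)"

end

theory Submission imports Defs begin

text \<open>Take a chart \<open>X\<close> of \<open>M\<close> with unit normal \<open>n\<close>, and let \<open>y\<close> be the tangential part of \<open>Y\<close>.
  Differentiating \<open>\<langle>n, Y\<rangle> = const\<close> shows that \<open>y\<close> is orthogonal to the image of \<open>dn\<close>, so \<open>dn\<close> vanishes in
  the direction of \<open>y\<close> by symmetry of the second fundamental form. Hence \<open>y\<close> changes along itself only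
  by a multiple of itself: where \<open>y \<noteq> 0\<close>, the unit field \<open>e = y / |y|\<close> is constant along its own direction,
  and \<open>M\<close> is ruled by straight segments in that direction.

  Such a field yields a ruled parametrization (lemma \<open>ruled_parametrization\<close>), and a curve in \<open>M\<close> that is
  orthogonal to the rulings and lies in a totally umbilical surface \<open>S\<close> orthogonal to \<open>Y\<close> turns it
  into the claimed one (lemma \<open>darboux_parametrization\<close>). If \<open>\<mu> = 0\<close>, then \<open>|y|\<close> is constant, and not \<open>0\<close>
  because \<open>M\<close> is not planar; here \<open>S\<close> is a plane. If \<open>\<mu> \<noteq> 0\<close>, one may take \<open>Y q = q - p0\<close>, so that
  \<open>X = p0 + c n + \<sigma> e\<close> with a constant \<open>c\<close> and \<open>\<sigma> = |y|\<close>, and \<open>S\<close> is a sphere about \<open>p0\<close>.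

  It remains to treat the points with \<open>y = 0\<close> in the second case. If \<open>dy\<close> is injective at such a point, all
  nearby rulings issue from it; \<open>n\<close> is constant along each of them, so \<open>M\<close> is flat there and the point is a
  planar vertex (lemma \<open>planar_vertex_if_nondegenerate\<close>). Otherwise \<open>dn\<close> has rank one nearby, and the
  rulings are the lines of its kernel, which extend smoothly across the zeros of \<open>y\<close>, as happens on a
  cylinder around an axis through \<open>p0\<close> (lemma \<open>darboux_ruled_at_degenerate_point\<close>). This uses that \<open>y\<close>
  does not vanish on an open set: such a set would be a spherical piece of \<open>M\<close>, and the Gauss
  curvature, \<open>1 / c\<^sup>2\<close> there and \<open>0\<close> where \<open>y \<noteq> 0\<close>, could not jump at its boundary, so all of \<open>M\<close> would lie
  on a sphere (lemma \<open>spherical_if_locally_spherical\<close>).\<close>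

section \<open>Calculus of smooth maps\<close>

abbreviation fd :: "('a::real_normed_vector \<Rightarrow> 'b::real_normed_vector) \<Rightarrow> 'a \<Rightarrow> 'a \<Rightarrow> 'b" where
  "fd f x \<equiv> frechet_derivative f (at x)"

lemma fd_eq: "(f has_derivative f') (at x) \<Longrightarrow> fd f x = f'"
  by (metis frechet_derivative_at)

lemma Ck_on_cong:
  assumes "open U" "\<And>x. x \<in> U \<Longrightarrow> f x = g x" "Ck_on k f U"
  shows "Ck_on k g U"
  using assms(2,3)
proof (induction k arbitrary: f g)
  case 0
  then show ?case by (metis Ck_on.simps(1) continuous_on_cong)
next
  case (Suc k)
  have g: "(g has_derivative fd f x) (at x)" if "x \<in> U" for x
  proof (rule has_derivative_transform_within_open[OF _ \<open>open U\<close> that])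
    show "(f has_derivative fd f x) (at x)"
      using Suc.prems(2) that by (simp add: frechet_derivative_works)
    show "f y = g y" if "y \<in> U" for y
      using Suc.prems(1) that by blast
  qed
  have "Ck_on k (\<lambda>x. fd g x v) U" for v
  proof (rule Suc.IH)
    show "fd f x v = fd g x v" if "x \<in> U" for x
      using fd_eq[OF g[OF that]] by simp
    show "Ck_on k (\<lambda>x. fd f x v) U"
      using Suc.prems(2) by simp
  qed
  then show ?case
    using g by (auto simp: differentiable_def)
qed

lemma Ck_on_SucI:
  assumes "open U" "\<And>x. x \<in> U \<Longrightarrow> (f has_derivative f' x) (at x)" "\<And>v. Ck_on k (\<lambda>x. f' x v) U"
  shows "Ck_on (Suc k) f U"
proof -
  have "fd f x = f' x" if "x \<in> U" for x
    using assms(2) fd_eq that by blast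
  then have "Ck_on k (\<lambda>x. fd f x v) U" for v
    by (intro Ck_on_cong[OF assms(1) _ assms(3)]) simp
  then show ?thesis
    using assms(2) by (auto simp: differentiable_def)
qed

lemma Ck_on_Suc_lower: "Ck_on (Suc k) f U \<Longrightarrow> Ck_on k f U"
proof (induction k arbitrary: f)
  case 0
  then show ?case
    by (metis Ck_on.simps continuous_at_imp_continuous_on differentiable_imp_continuous_within)
next
  case (Suc k)
  have diff: "\<forall>x\<in>U. f differentiable (at x)" and "\<forall>v. Ck_on (Suc k) (\<lambda>x. fd f x v) U"
    using iffD1[OF Ck_on.simps(2) Suc.prems] by blast+
  then have "Ck_on k (\<lambda>x. fd f x v) U" for v
    using Suc.IH[of "\<lambda>x. fd f x v"] by blast
  then show ?case
    using diff by (intro iffD2[OF Ck_on.simps(2)] conjI) blast+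
qed

lemma Ck_on_SucD:
  assumes "Ck_on (Suc k) f U"
  shows "x \<in> U \<Longrightarrow> (f has_derivative fd f x) (at x)" "Ck_on k (\<lambda>x. fd f x v) U"
  using assms unfolding frechet_derivative_works[symmetric] by simp_all

lemma Ck_on_const: "open U \<Longrightarrow> Ck_on k (\<lambda>x. c) U"
proof (induction k arbitrary: c)
  case 0
  then show ?case by simp
next
  case (Suc k)
  show ?case
    using Suc by (intro Ck_on_SucI[where f' = "\<lambda>x v. 0"] has_derivative_const)
qed

lemma Ck_on_linear: "open U \<Longrightarrow> bounded_linear f \<Longrightarrow> Ck_on k f U"
proof (cases k)
  case 0
  assume "bounded_linear f"
  then show ?thesis using 0 by (simp add: linear_continuous_on)
next
  case (Suc l)
  assume "open U" "bounded_linear f"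
  then show ?thesis unfolding Suc
    by (intro Ck_on_SucI[where f' = "\<lambda>x. f"] bounded_linear_imp_has_derivative Ck_on_const)
qed

lemma Ck_on_add: "open U \<Longrightarrow> Ck_on k f U \<Longrightarrow> Ck_on k g U \<Longrightarrow> Ck_on k (\<lambda>x. f x + g x) U"
proof (induction k arbitrary: f g)
  case 0
  then show ?case by (simp add: continuous_on_add)
next
  case (Suc k)
  show ?case
    by (rule Ck_on_SucI[OF Suc.prems(1)
          has_derivative_add[OF Ck_on_SucD(1)[OF Suc.prems(2)] Ck_on_SucD(1)[OF Suc.prems(3)]]
          Suc.IH[OF Suc.prems(1) Ck_on_SucD(2)[OF Suc.prems(2)] Ck_on_SucD(2)[OF Suc.prems(3)]]])
qed

lemma Ck_on_sum:
  assumes "open U" "\<And>i. i \<in> A \<Longrightarrow> Ck_on k (f i) U"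
  shows "Ck_on k (\<lambda>x. \<Sum>i\<in>A. f i x) U"
  using assms(2)
  by (induction A rule: infinite_finite_induct) (simp_all add: Ck_on_const Ck_on_add assms(1))

lemma Ck_on_bilinear:
  assumes "bounded_bilinear B" "open U"
  shows "Ck_on k f U \<Longrightarrow> Ck_on k g U \<Longrightarrow> Ck_on k (\<lambda>x. B (f x) (g x)) U"
proof (induction k arbitrary: f g)
  case 0
  then show ?case by (simp add: bounded_bilinear.continuous_on[OF assms(1)])
next
  case (Suc k)
  have "Ck_on k (\<lambda>x. B (f x) (fd g x v) + B (fd f x v) (g x)) U" for v
    using Ck_on_SucD(2)[OF Suc.prems(1)] Ck_on_SucD(2)[OF Suc.prems(2)]
      Ck_on_Suc_lower[OF Suc.prems(1)] Ck_on_Suc_lower[OF Suc.prems(2)]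
    by (intro Ck_on_add Suc.IH assms(2))
  then show ?case
    by (rule Ck_on_SucI[OF assms(2), rotated])
       (rule bounded_bilinear.FDERIV[OF assms(1) Ck_on_SucD(1)[OF Suc.prems(1)] Ck_on_SucD(1)[OF Suc.prems(2)]])
qed

text \<open>A directional derivative of a composition is a sum, over a basis, of products of functions of
  the same kind with one derivative less, so the claim follows by induction on the order.\<close>

lemma Ck_on_compose:
  fixes f :: "'a::euclidean_space \<Rightarrow> 'b::euclidean_space"
  assumes "open U" "open V" "f ` U \<subseteq> V"
  shows "Ck_on k g V \<Longrightarrow> Ck_on k f U \<Longrightarrow> Ck_on k (\<lambda>x. g (f x)) U"
proof (induction k arbitrary: g)
  case 0
  then show ?case using assms(3) by (auto intro: continuous_on_compose2)
next
  case (Suc k)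
  let ?f' = "\<lambda>x v. \<Sum>b\<in>Basis. (fd f x v \<bullet> b) *\<^sub>R fd g (f x) b"
  have "((\<lambda>x. g (f x)) has_derivative ?f' x) (at x)" if "x \<in> U" for x
  proof -
    have g: "(g has_derivative fd g (f x)) (at (f x))"
      using Ck_on_SucD(1)[OF Suc.prems(1)] assms(3) that by blast
    have expand: "fd g (f x) w = (\<Sum>b\<in>Basis. (w \<bullet> b) *\<^sub>R fd g (f x) b)" for w
    proof -
      have "fd g (f x) (\<Sum>b\<in>Basis. (w \<bullet> b) *\<^sub>R b) = (\<Sum>b\<in>Basis. (w \<bullet> b) *\<^sub>R fd g (f x) b)"
        by (simp add: linear_sum[OF has_derivative_linear[OF g]] linear_cmul[OF has_derivative_linear[OF g]])
      then show ?thesis by (simp only: euclidean_representation)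
    qed
    have "?f' x = (\<lambda>v. fd g (f x) (fd f x v))"
      by (rule ext) (rule expand[symmetric])
    then show ?thesis
      using has_derivative_compose[OF Ck_on_SucD(1)[OF Suc.prems(2) that] g] by (simp only:)
  qed
  moreover have "Ck_on k (\<lambda>x. ?f' x v) U" for v
  proof (rule Ck_on_sum[OF assms(1)])
    fix b :: 'b assume "b \<in> Basis"
    have "Ck_on k (\<lambda>x. fd f x v \<bullet> b) U"
      by (rule Ck_on_bilinear[OF bounded_bilinear_inner assms(1) Ck_on_SucD(2)[OF Suc.prems(2)]
            Ck_on_const[OF assms(1)]])
    moreover have "Ck_on k (\<lambda>x. fd g (f x) b) U"
      by (rule Suc.IH[OF Ck_on_SucD(2)[OF Suc.prems(1)] Ck_on_Suc_lower[OF Suc.prems(2)]])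
    ultimately show "Ck_on k (\<lambda>x. (fd f x v \<bullet> b) *\<^sub>R fd g (f x) b) U"
      by (rule Ck_on_bilinear[OF bounded_bilinear_scaleR assms(1)])
  qed
  ultimately show ?case
    by (rule Ck_on_SucI[OF assms(1)])
qed

lemma smooth_on_subset: "smooth_on U f \<Longrightarrow> V \<subseteq> U \<Longrightarrow> smooth_on V f"
proof -
  have "Ck_on k f U \<Longrightarrow> V \<subseteq> U \<Longrightarrow> Ck_on k f V" for k
    by (induction k arbitrary: f) (auto intro: continuous_on_subset)
  then show "smooth_on U f \<Longrightarrow> V \<subseteq> U \<Longrightarrow> smooth_on V f"
    by (auto simp: smooth_on_def)
qed

lemma smooth_on_cong: "smooth_on U f \<Longrightarrow> open U \<Longrightarrow> (\<And>x. x \<in> U \<Longrightarrow> f x = g x) \<Longrightarrow> smooth_on U g"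
  unfolding smooth_on_def using Ck_on_cong by blast

lemma smooth_on_has_derivative: "smooth_on U f \<Longrightarrow> x \<in> U \<Longrightarrow> (f has_derivative fd f x) (at x)"
  unfolding smooth_on_def frechet_derivative_works[symmetric] by (metis Ck_on.simps(2))

lemma smooth_on_fd: "smooth_on U f \<Longrightarrow> smooth_on U (\<lambda>x. fd f x v)"
  unfolding smooth_on_def by (metis Ck_on.simps(2))

lemma smooth_on_continuous: "smooth_on U f \<Longrightarrow> continuous_on U f"
  unfolding smooth_on_def by (metis Ck_on.simps(1))

lemma smooth_on_by_derivative:
  assumes "open U" "\<And>x. x \<in> U \<Longrightarrow> (f has_derivative f' x) (at x)" "\<And>v. smooth_on U (\<lambda>x. f' x v)"
  shows "smooth_on U f"
  unfolding smooth_on_def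
proof
  fix k
  have "Ck_on (Suc k) f U"
    using assms by (intro Ck_on_SucI[where f' = f']) (auto simp: smooth_on_def)
  then show "Ck_on k f U" by (rule Ck_on_Suc_lower)
qed

lemma smooth_on_const: "open U \<Longrightarrow> smooth_on U (\<lambda>x. c)"
  by (simp add: smooth_on_def Ck_on_const)

lemma smooth_on_linear: "open U \<Longrightarrow> bounded_linear f \<Longrightarrow> smooth_on U f"
  by (simp add: smooth_on_def Ck_on_linear)

lemma smooth_on_add: "open U \<Longrightarrow> smooth_on U f \<Longrightarrow> smooth_on U g \<Longrightarrow> smooth_on U (\<lambda>x. f x + g x)"
  by (simp add: smooth_on_def Ck_on_add)

lemma smooth_on_bilinear:
  "bounded_bilinear B \<Longrightarrow> open U \<Longrightarrow> smooth_on U f \<Longrightarrow> smooth_on U g \<Longrightarrow> smooth_on U (\<lambda>x. B (f x) (g x))"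
  by (simp add: smooth_on_def Ck_on_bilinear)

lemmas smooth_on_scaleR = smooth_on_bilinear[OF bounded_bilinear_scaleR]
lemmas smooth_on_inner = smooth_on_bilinear[OF bounded_bilinear_inner]
lemmas smooth_on_mult = smooth_on_bilinear[OF bounded_bilinear_mult]

lemma bounded_bilinear_cross3: "bounded_bilinear cross3"
  using bilinear_cross bilinear_conv_bounded_bilinear by blast

lemmas smooth_on_cross3 = smooth_on_bilinear[OF bounded_bilinear_cross3]

lemma smooth_on_compose:
  fixes f :: "'a::euclidean_space \<Rightarrow> 'b::euclidean_space"
  assumes "smooth_on V g" "smooth_on U f" "open U" "open V" "f ` U \<subseteq> V"
  shows "smooth_on U (\<lambda>x. g (f x))"
  using assms Ck_on_compose unfolding smooth_on_def by blast

lemma smooth_on_minus: "open U \<Longrightarrow> smooth_on U f \<Longrightarrow> smooth_on U (\<lambda>x. - f x)"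
  using smooth_on_scaleR[OF _ smooth_on_const, of U f "-1"] by simp

lemma smooth_on_diff: "open U \<Longrightarrow> smooth_on U f \<Longrightarrow> smooth_on U g \<Longrightarrow> smooth_on U (\<lambda>x. f x - g x)"
  using smooth_on_add[OF _ _ smooth_on_minus, of U f g] by simp

lemmas smooth_intros = smooth_on_const smooth_on_add smooth_on_diff smooth_on_minus smooth_on_scaleR
  smooth_on_inner smooth_on_mult smooth_on_cross3 smooth_on_fd

lemma smooth_on_inverse:
  fixes f :: "'a::euclidean_space \<Rightarrow> real"
  assumes "open U" "smooth_on U f" "\<And>x. x \<in> U \<Longrightarrow> f x \<noteq> 0"
  shows "smooth_on U (\<lambda>x. inverse (f x))"
proof -
  have op: "open (- {0::real})" by (simp add: open_Compl)
  have "Ck_on k inverse (- {0::real})" for k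
  proof (induction k)
    case 0
    then show ?case by (auto intro!: continuous_intros)
  next
    case (Suc k)
    show ?case
    proof (rule Ck_on_SucI[where f' = "\<lambda>x v. - (inverse x * v * inverse x)"])
      show "Ck_on k (\<lambda>x. - (inverse x * v * inverse x)) (- {0::real})" for v
        using Ck_on_bilinear[OF bounded_bilinear_mult op Ck_on_bilinear[OF bounded_bilinear_mult op Suc Ck_on_const[OF op, of _ "-v"]] Suc]
        by simp
    qed (auto simp: op intro!: has_derivative_inverse')
  qed
  then have "smooth_on (- {0}) (inverse :: real \<Rightarrow> real)"
    by (simp add: smooth_on_def)
  then show ?thesis
    by (rule smooth_on_compose) (use assms op in auto)
qed

lemma smooth_on_sqrt:
  fixes f :: "'a::euclidean_space \<Rightarrow> real"
  assumes "open U" "smooth_on U f" "\<And>x. x \<in> U \<Longrightarrow> f x > 0"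
  shows "smooth_on U (\<lambda>x. sqrt (f x))"
proof -
  have op: "open {0::real<..}" by simp
  have pos: "sqrt ` {0<..} \<subseteq> {0<..}"
    by (intro image_subsetI) simp
  have "Ck_on k sqrt {0<..}" for k
  proof (induction k)
    case 0
    then show ?case by (auto intro!: continuous_intros)
  next
    case (Suc k)
    show ?case
    proof (rule Ck_on_SucI[where f' = "\<lambda>x v. v * (inverse (sqrt x) / 2)"])
      have "smooth_on {0<..} (inverse :: real \<Rightarrow> real)"
        using smooth_on_inverse[OF op smooth_on_linear[OF op bounded_linear_ident]] by simp
      then have "Ck_on k (\<lambda>x. inverse (sqrt x)) {0<..}"
        unfolding smooth_on_def using Ck_on_compose[OF op op pos _ Suc, of inverse] by blast
      from Ck_on_bilinear[OF bounded_bilinear_mult op Ck_on_const[OF op] this]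
      show "Ck_on k (\<lambda>x. v * (inverse (sqrt x) / 2)) {0<..}" for v
        by (metis (no_types, lifting) Ck_on_cong op times_divide_eq_left times_divide_eq_right)
      show "(sqrt has_derivative (\<lambda>v. v * (inverse (sqrt x) / 2))) (at x)" if "x \<in> {0<..}" for x
      proof -
        have "(*) (inverse (sqrt x) / 2) = (\<lambda>v. v * (inverse (sqrt x) / 2))"
          by (simp add: fun_eq_iff)
        then show ?thesis
          using DERIV_real_sqrt[of x] that by (simp add: has_field_derivative_def)
      qed
    qed (auto simp: op)
  qed
  then have "smooth_on {0<..} sqrt"
    by (simp add: smooth_on_def)
  then show ?thesis
    by (rule smooth_on_compose) (use assms op in auto)
qed

lemma smooth_on_norm:
  fixes f :: "'a::euclidean_space \<Rightarrow> 'b::real_inner"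
  assumes "open U" "smooth_on U f" "\<And>x. x \<in> U \<Longrightarrow> f x \<noteq> 0"
  shows "smooth_on U (\<lambda>x. norm (f x))"
  unfolding norm_eq_sqrt_inner
  by (rule smooth_on_sqrt) (use assms in \<open>auto intro: smooth_on_inner\<close>)

lemma smooth_on_sgn:
  fixes f :: "'a::euclidean_space \<Rightarrow> 'b::real_inner"
  assumes "open U" "smooth_on U f" "\<And>x. x \<in> U \<Longrightarrow> f x \<noteq> 0"
  shows "smooth_on U (\<lambda>x. sgn (f x))"
  unfolding sgn_div_norm
  by (intro smooth_on_scaleR smooth_on_inverse smooth_on_norm) (use assms in auto)

lemma fd_cong_open:
  assumes "open U" "x \<in> U" "\<And>y. y \<in> U \<Longrightarrow> f y = g y"
  shows "fd f x = fd g x"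
proof -
  have "(f has_derivative f') (at x) \<longleftrightarrow> (g has_derivative f') (at x)" for f'
    by (metis assms has_derivative_transform_within_open)
  then show ?thesis unfolding frechet_derivative_def by simp
qed

lemma fd_add:
  "smooth_on U f \<Longrightarrow> smooth_on U g \<Longrightarrow> x \<in> U \<Longrightarrow> fd (\<lambda>x. f x + g x) x v = fd f x v + fd g x v"
  using fd_eq[OF has_derivative_add[OF smooth_on_has_derivative smooth_on_has_derivative]] by metis

lemma fd_diff:
  "smooth_on U f \<Longrightarrow> smooth_on U g \<Longrightarrow> x \<in> U \<Longrightarrow> fd (\<lambda>x. f x - g x) x v = fd f x v - fd g x v"
  using fd_eq[OF has_derivative_diff[OF smooth_on_has_derivative smooth_on_has_derivative]] by metis

lemma fd_bilinear:
  assumes "bounded_bilinear B" "smooth_on U f" "smooth_on U g" "x \<in> U"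
  shows "fd (\<lambda>x. B (f x) (g x)) x v = B (f x) (fd g x v) + B (fd f x v) (g x)"
  using fd_eq[OF bounded_bilinear.FDERIV[OF assms(1) smooth_on_has_derivative smooth_on_has_derivative]]
    assms by metis

lemmas fd_inner = fd_bilinear[OF bounded_bilinear_inner]
lemmas fd_scaleR = fd_bilinear[OF bounded_bilinear_scaleR]

lemma fd_const [simp]: "fd (\<lambda>x. c) x v = 0"
  by (simp add: fd_eq)

lemma fd_linear: "smooth_on U f \<Longrightarrow> x \<in> U \<Longrightarrow> linear (fd f x)"
  using smooth_on_has_derivative has_derivative_linear by blast

lemma fd_inner_const:
  assumes "smooth_on U f" "x \<in> U"
  shows "fd (\<lambda>x. f x \<bullet> c) x v = fd f x v \<bullet> c"
  using fd_eq[OF has_derivative_inner_left[OF smooth_on_has_derivative[OF assms]]] by metis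

lemma constant_inner_fd:
  assumes "open U" "smooth_on U f" "smooth_on U g" "\<And>u. u \<in> U \<Longrightarrow> f u \<bullet> g u = c" "u \<in> U"
  shows "f u \<bullet> fd g u a = - (fd f u a \<bullet> g u)"
proof -
  have "fd (\<lambda>u. f u \<bullet> g u) u a = fd (\<lambda>u. c) u a"
    using assms(4) by (intro fun_cong[OF fd_cong_open[OF assms(1,5)]]) simp
  then show ?thesis
    by (simp add: fd_inner[OF assms(2,3,5)])
qed

lemma unit_fd_orthogonal:
  assumes "open U" "smooth_on U e" "\<And>u. u \<in> U \<Longrightarrow> norm (e u) = 1" "u \<in> U"
  shows "e u \<bullet> fd e u a = 0"
  using constant_inner_fd[OF assms(1,2,2) _ assms(4), of 1 a] assms(3)
  by (simp add: norm_eq_1 inner_commute)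

lemma curve_has_derivative:
  assumes "smooth_on U f" "x + t *\<^sub>R k \<in> U"
  shows "((\<lambda>t. f (x + t *\<^sub>R k)) has_vector_derivative fd f (x + t *\<^sub>R k) k) (at t)"
proof -
  have "((\<lambda>t. x + t *\<^sub>R k) has_derivative (\<lambda>s. s *\<^sub>R k)) (at t)"
    by (auto intro!: derivative_eq_intros)
  from has_derivative_compose[OF this smooth_on_has_derivative[OF assms]]
  show ?thesis
    using fd_linear[OF assms] by (simp add: has_vector_derivative_def linear_cmul)
qed

lemma smooth_on_curve:
  assumes "smooth_on U f" "open U" "open I" "\<And>t. t \<in> I \<Longrightarrow> x + t *\<^sub>R k \<in> U"
  shows "smooth_on I (\<lambda>t. f (x + t *\<^sub>R k))"
proof (rule smooth_on_compose[OF assms(1) _ assms(3,2)])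
  show "smooth_on I (\<lambda>t. x + t *\<^sub>R k)"
    by (intro smooth_on_add smooth_on_const smooth_on_linear assms bounded_linear_scaleR_left)
qed (use assms(4) in auto)

text \<open>Symmetry of second derivatives. By two applications of the mean value theorem, the second
  difference of \<open>f\<close> over a small parallelogram is the mixed derivative at some point of it, taken in
  either order; letting the parallelogram shrink to a point gives the claim.\<close>

lemma second_difference:
  fixes f :: "'a::euclidean_space \<Rightarrow> real"
  assumes "ball u r \<subseteq> U" "open U" "smooth_on U f" "h > 0" "h * (norm a + norm b) < r"
  shows "\<exists>p. dist u p \<le> h * (norm a + norm b) \<and>
    f (u + h *\<^sub>R a + h *\<^sub>R b) - f (u + h *\<^sub>R a) - f (u + h *\<^sub>R b) + f u
      = h * h * fd (\<lambda>x. fd f x a) p b"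
proof -
  have bound: "dist u (u + s *\<^sub>R a + t *\<^sub>R b) \<le> h * (norm a + norm b)"
    if "0 \<le> s" "s \<le> h" "0 \<le> t" "t \<le> h" for s t
  proof -
    have "dist u (u + s *\<^sub>R a + t *\<^sub>R b) = norm (s *\<^sub>R a + t *\<^sub>R b)"
      by (subst dist_commute) (simp only: dist_norm add.assoc add_diff_cancel_left')
    also have "\<dots> \<le> s * norm a + t * norm b"
      using that by (metis abs_of_nonneg norm_scaleR norm_triangle_ineq)
    also have "\<dots> \<le> h * norm a + h * norm b"
      using that by (intro add_mono mult_right_mono) auto
    finally show ?thesis by (simp add: distrib_left)
  qed
  then have inU: "u + s *\<^sub>R a + t *\<^sub>R b \<in> U" if "0 \<le> s" "s \<le> h" "0 \<le> t" "t \<le> h" for s t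
    using assms(1,5) that by (meson le_less_trans mem_ball subsetD)
  have line: "((\<lambda>s. g (x + s *\<^sub>R k)) has_real_derivative fd g (x + s *\<^sub>R k) k) (at s)"
    if "smooth_on U g" "x + s *\<^sub>R k \<in> U" for g :: "'a \<Rightarrow> real" and x k s
    using curve_has_derivative[OF that] by (simp add: has_real_derivative_iff_has_vector_derivative)
  define G where "G s = f (u + h *\<^sub>R b + s *\<^sub>R a) - f (u + s *\<^sub>R a)" for s
  have "\<exists>z>0. z < h \<and> G h - G 0 = (h - 0) * (fd f (u + h *\<^sub>R b + z *\<^sub>R a) a - fd f (u + z *\<^sub>R a) a)"
  proof (rule MVT2)
    fix s assume "0 \<le> s" "s \<le> h"
    then have "u + h *\<^sub>R b + s *\<^sub>R a \<in> U" "u + s *\<^sub>R a \<in> U"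
      using inU[of s h] inU[of s 0] \<open>h > 0\<close> by (simp_all add: ac_simps)
    then show "(G has_real_derivative fd f (u + h *\<^sub>R b + s *\<^sub>R a) a - fd f (u + s *\<^sub>R a) a) (at s)"
      unfolding G_def using assms(3) by (intro DERIV_diff line)
  qed fact
  then obtain z where z: "0 < z" "z < h"
    "G h - G 0 = h * (fd f (u + h *\<^sub>R b + z *\<^sub>R a) a - fd f (u + z *\<^sub>R a) a)" by auto
  define H where "H t = fd f (u + z *\<^sub>R a + t *\<^sub>R b) a" for t
  have "\<exists>t>0. t < h \<and> H h - H 0 = (h - 0) * fd (\<lambda>x. fd f x a) (u + z *\<^sub>R a + t *\<^sub>R b) b"
  proof (rule MVT2)
    fix t assume "0 \<le> t" "t \<le> h"
    then show "(H has_real_derivative fd (\<lambda>x. fd f x a) (u + z *\<^sub>R a + t *\<^sub>R b) b) (at t)"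
      unfolding H_def using assms(3) z inU by (intro line smooth_on_fd) auto
  qed fact
  then obtain t where t: "0 < t" "t < h"
    "H h - H 0 = h * fd (\<lambda>x. fd f x a) (u + z *\<^sub>R a + t *\<^sub>R b) b" by auto
  have "f (u + h *\<^sub>R a + h *\<^sub>R b) - f (u + h *\<^sub>R a) - f (u + h *\<^sub>R b) + f u = G h - G 0"
    by (simp add: G_def ac_simps)
  also have "\<dots> = h * (H h - H 0)"
    using z(3) by (simp add: H_def ac_simps)
  also have "\<dots> = h * h * fd (\<lambda>x. fd f x a) (u + z *\<^sub>R a + t *\<^sub>R b) b"
    using t(3) by simp
  finally show ?thesis
    using bound z t by (intro exI[of _ "u + z *\<^sub>R a + t *\<^sub>R b"]) auto
qed

lemma fd_commute_real:
  fixes f :: "'a::euclidean_space \<Rightarrow> real"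
  assumes "open U" "smooth_on U f" "u \<in> U"
  shows "fd (\<lambda>x. fd f x a) u b = fd (\<lambda>x. fd f x b) u a"
proof -
  obtain r where r: "r > 0" "ball u r \<subseteq> U"
    using assms by (meson openE)
  define K where "K = norm a + norm b + 1"
  define h where "h n = r / (K * real (Suc n))" for n
  have K: "K > 0" by (simp add: K_def add_nonneg_pos)
  have h: "h n > 0" for n using r K by (simp add: h_def)
  have hK: "h n * (norm a + norm b) < r" for n
  proof -
    have "h n * (norm a + norm b) < h n * K" using h by (simp add: K_def)
    also have "\<dots> = r / real (Suc n)" using K by (simp add: h_def)
    also have "\<dots> \<le> r" using r by (simp add: field_simps)
    finally show ?thesis .
  qed
  have lim0: "(\<lambda>n. h n * (norm a + norm b)) \<longlonglongrightarrow> 0"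
    unfolding h_def
    using tendsto_mult_right_zero[OF LIMSEQ_Suc[OF lim_1_over_n], of "r / K"]
    by (intro tendsto_mult_left_zero) (simp add: field_simps)
  have "\<exists>p. dist u p \<le> h n * (norm a + norm b) \<and>
    f (u + h n *\<^sub>R a + h n *\<^sub>R b) - f (u + h n *\<^sub>R a) - f (u + h n *\<^sub>R b) + f u
      = h n * h n * fd (\<lambda>x. fd f x a) p b" for n
    by (rule second_difference[OF r(2) assms(1,2) h hK])
  then obtain p where p: "\<And>n. dist u (p n) \<le> h n * (norm a + norm b)"
    "\<And>n. f (u + h n *\<^sub>R a + h n *\<^sub>R b) - f (u + h n *\<^sub>R a) - f (u + h n *\<^sub>R b) + f u
      = h n * h n * fd (\<lambda>x. fd f x a) (p n) b" by metis
  have "\<exists>p. dist u p \<le> h n * (norm b + norm a) \<and>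
    f (u + h n *\<^sub>R b + h n *\<^sub>R a) - f (u + h n *\<^sub>R b) - f (u + h n *\<^sub>R a) + f u
      = h n * h n * fd (\<lambda>x. fd f x b) p a" for n
    using hK by (intro second_difference[OF r(2) assms(1,2) h]) (simp add: add.commute)
  then obtain q where q: "\<And>n. dist u (q n) \<le> h n * (norm b + norm a)"
    "\<And>n. f (u + h n *\<^sub>R b + h n *\<^sub>R a) - f (u + h n *\<^sub>R b) - f (u + h n *\<^sub>R a) + f u
      = h n * h n * fd (\<lambda>x. fd f x b) (q n) a" by metis
  have "(h n * h n) * fd (\<lambda>x. fd f x a) (p n) b = h n * h n * fd (\<lambda>x. fd f x b) (q n) a" for n
  proof -
    have e: "u + h n *\<^sub>R b + h n *\<^sub>R a = u + h n *\<^sub>R a + h n *\<^sub>R b" by simp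
    then show ?thesis using p(2)[of n] q(2)[of n] unfolding e by linarith
  qed
  then have eq: "fd (\<lambda>x. fd f x a) (p n) b = fd (\<lambda>x. fd f x b) (q n) a" for n
    using h[of n] mult_left_cancel[of "h n * h n"] by (metis less_irrefl mult_pos_pos)
  have near: "z \<longlonglongrightarrow> u" if "\<And>n. dist u (z n) \<le> h n * (norm a + norm b)" for z
  proof (rule metric_tendsto_imp_tendsto[OF lim0])
    have "dist (z n) u \<le> dist (h n * (norm a + norm b)) 0" for n
      using order_trans[OF that abs_ge_self] by (simp only: dist_commute[of "z n"] dist_real_def diff_zero)
    then show "\<forall>\<^sub>F n in sequentially. dist (z n) u \<le> dist (h n * (norm a + norm b)) 0"
      by (rule always_eventually[OF allI])
  qed
  have cont: "isCont (\<lambda>x. fd (\<lambda>x. fd f x v) x w) u" for v w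
    using smooth_on_continuous[OF smooth_on_fd[OF smooth_on_fd[OF assms(2)]]] assms(1,3)
    by (simp add: continuous_on_eq_continuous_at)
  have "(\<lambda>n. fd (\<lambda>x. fd f x a) (p n) b) \<longlonglongrightarrow> fd (\<lambda>x. fd f x a) u b"
    by (rule isCont_tendsto_compose[OF cont near]) (rule p(1))
  moreover have "(\<lambda>n. fd (\<lambda>x. fd f x a) (p n) b) \<longlonglongrightarrow> fd (\<lambda>x. fd f x b) u a"
    unfolding eq by (rule isCont_tendsto_compose[OF cont near]) (use q(1) in \<open>simp add: add.commute\<close>)
  ultimately show ?thesis by (rule LIMSEQ_unique)
qed

lemma fd_commute:
  fixes f :: "'a::euclidean_space \<Rightarrow> 'b::euclidean_space"
  assumes "open U" "smooth_on U f" "u \<in> U"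
  shows "fd (\<lambda>x. fd f x a) u b = fd (\<lambda>x. fd f x b) u a"
proof (rule euclidean_eqI)
  fix i :: 'b
  have "fd (\<lambda>x. fd f x v) u w \<bullet> i = fd (\<lambda>x. fd (\<lambda>x. f x \<bullet> i) x v) u w" for v w
  proof -
    have "fd (\<lambda>x. fd f x v) u w \<bullet> i = fd (\<lambda>x. fd f x v \<bullet> i) u w"
      using fd_inner_const[OF smooth_on_fd[OF assms(2)] assms(3)] by simp
    also have "\<dots> = fd (\<lambda>x. fd (\<lambda>x. f x \<bullet> i) x v) u w"
      by (intro fun_cong[OF fd_cong_open[OF assms(1,3)]]) (simp add: fd_inner_const[OF assms(2)])
    finally show ?thesis .
  qed
  then show "fd (\<lambda>x. fd f x a) u b \<bullet> i = fd (\<lambda>x. fd f x b) u a \<bullet> i"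
    using fd_commute_real[OF assms(1) smooth_on_inner[OF assms(1,2) smooth_on_const[OF assms(1)]] assms(3)]
    by simp
qed

text \<open>In finite dimension, continuity of all directional derivatives makes the derivative continuous in
  the operator norm.\<close>

lemma smooth_inverse_function:
  fixes f :: "'a::euclidean_space \<Rightarrow> 'a"
  assumes "open D" "smooth_on D f" "u0 \<in> D" "inj (fd f u0)"
  obtains U V g where "open U" "U \<subseteq> D" "u0 \<in> U" "open V" "homeomorphism U V f g"
    "\<And>y. y \<in> V \<Longrightarrow> \<exists>g'. (g has_derivative g') (at y) \<and>
       (\<forall>k. fd f (g y) (g' k) = k) \<and> (\<forall>k. g' (fd f (g y) k) = k)"
proof -
  define f' where "f' x = Blinfun (fd f x)" for x
  have f': "blinfun_apply (f' x) = fd f x" if "x \<in> D" for x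
    using has_derivative_bounded_linear[OF smooth_on_has_derivative[OF assms(2) that]]
    by (simp add: f'_def bounded_linear_Blinfun_apply)
  obtain L where L: "linear L" "L \<circ> fd f u0 = id"
    using linear_injective_left_inverse[OF fd_linear[OF assms(2,3)] assms(4)] by blast
  have "continuous_on D f'"
  proof (rule continuous_on_blinfun_componentwise)
    fix i :: 'a
    have "continuous_on D (\<lambda>x. fd f x i)"
      by (rule smooth_on_continuous[OF smooth_on_fd[OF assms(2)]])
    then show "continuous_on D (\<lambda>x. blinfun_apply (f' x) i)"
      by (simp cong: continuous_on_cong add: f')
  qed
  moreover have "Blinfun L o\<^sub>L f' u0 = id_blinfun"
    using L f'[OF assms(3)]
    by (intro blinfun_eqI)
       (simp add: linear_conv_bounded_linear bounded_linear_Blinfun_apply fun_eq_iff)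
  ultimately obtain U V g g' where *: "open U" "U \<subseteq> D" "u0 \<in> U" "open V" "homeomorphism U V f g"
    "\<And>y. y \<in> V \<Longrightarrow> (g has_derivative g' y) (at y)"
    "\<And>y. y \<in> V \<Longrightarrow> g' y = inv (blinfun_apply (f' (g y)))"
    "\<And>y. y \<in> V \<Longrightarrow> bij (blinfun_apply (f' (g y)))"
    using inverse_function_theorem[of D f f' u0 "Blinfun L"] smooth_on_has_derivative[OF assms(2)] f' assms
    by (metis (no_types, lifting))
  show ?thesis
  proof (rule that[OF *(1-5)])
    fix y assume y: "y \<in> V"
    then have "g y \<in> D" using *(2,5) homeomorphism_image2 by blast
    then have "bij (fd f (g y))" "g' y = inv (fd f (g y))"
      using *(7,8)[OF y] f' by auto
    then show "\<exists>g'. (g has_derivative g') (at y) \<and>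
       (\<forall>k. fd f (g y) (g' k) = k) \<and> (\<forall>k. g' (fd f (g y) k) = k)"
      using *(6)[OF y] by (intro exI[of _ "g' y"]) (simp add: bij_is_inj bij_is_surj surj_f_inv_f)
  qed
qed

section \<open>Regular parametrized surfaces\<close>

lemma local_parametrizationD:
  assumes "local_parametrization M X D"
  shows "open D" "smooth_on D X" "\<And>u. u \<in> D \<Longrightarrow> inj (fd X u)" "openin (top_of_set M) (X ` D)"
    "X ` D \<subseteq> M" "continuous_on D X" "inj_on X D"
proof -
  show *: "open D" "smooth_on D X" "\<And>u. u \<in> D \<Longrightarrow> inj (fd X u)" "openin (top_of_set M) (X ` D)"
    using assms by (auto simp: local_parametrization_def)
  show "X ` D \<subseteq> M" by (rule openin_imp_subset[OF *(4)])
  show "continuous_on D X" by (rule smooth_on_continuous[OF *(2)])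
  obtain G where "homeomorphism D (X ` D) X G"
    using assms by (auto simp: local_parametrization_def)
  then show "inj_on X D"
    by (intro inj_on_inverseI[of D G]) (simp add: homeomorphism_def)
qed

text \<open>By invariance of domain an injective change of parameters is a homeomorphism onto an open set.
  Only the new parametrization \<open>Z\<close> has to be smooth: \<open>\<kappa>\<close> may come from the inverse function theorem,
  which provides just its first derivative.\<close>

lemma local_parametrization_reparam:
  assumes X: "local_parametrization M X D" and R: "open R" "smooth_on R Z"
    and \<kappa>: "\<And>r. r \<in> R \<Longrightarrow> \<kappa> r \<in> D \<and> Z r = X (\<kappa> r)" "inj_on \<kappa> R"
      "\<And>r. r \<in> R \<Longrightarrow> \<exists>\<kappa>'. (\<kappa> has_derivative \<kappa>') (at r) \<and> inj \<kappa>'"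
  shows "local_parametrization M Z R"
proof -
  have D: "open D" "smooth_on D X" "\<And>u. u \<in> D \<Longrightarrow> inj (fd X u)" "openin (top_of_set M) (X ` D)"
    using local_parametrizationD[OF X] by blast+
  obtain G where G: "homeomorphism D (X ` D) X G"
    using X by (auto simp: local_parametrization_def)
  have cont: "continuous_on R \<kappa>"
    using \<kappa>(3) has_derivative_continuous by (blast intro: continuous_at_imp_continuous_on)
  have op: "open (\<kappa> ` R)"
    by (rule invariance_of_domain_gen[OF R(1) cont \<kappa>(2)]) simp
  have sub: "\<kappa> ` R \<subseteq> D" and img: "Z ` R = X ` \<kappa> ` R"
    using \<kappa>(1) by auto
  obtain K where K: "homeomorphism R (\<kappa> ` R) \<kappa> K"
    using invariance_of_domain_homeomorphism[OF R(1) cont _ \<kappa>(2)] by auto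
  have "homeomorphism (\<kappa> ` R) (X ` \<kappa> ` R) X G"
    by (rule homeomorphism_of_subsets[OF G sub]) auto
  then have "homeomorphism R (X ` \<kappa> ` R) (X \<circ> \<kappa>) (K \<circ> G)"
    by (rule homeomorphism_compose[OF K])
  then have "homeomorphism R (Z ` R) Z (K \<circ> G)"
    unfolding img by (rule homeomorphism_cong) (use \<kappa>(1) in auto)
  moreover have "openin (top_of_set (X ` D)) (X ` \<kappa> ` R)"
    using homeomorphism_imp_open_map[OF G] op sub open_openin_trans D(1)
    by (metis open_subset openin_subset_trans)
  then have "openin (top_of_set M) (Z ` R)"
    unfolding img using D(4) openin_trans by blast
  moreover have "inj (fd Z r)" if r: "r \<in> R" for r
  proof -
    obtain \<kappa>' where k: "(\<kappa> has_derivative \<kappa>') (at r)" "inj \<kappa>'" using \<kappa>(3)[OF r] by blast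
    have "(X has_derivative fd X (\<kappa> r)) (at (\<kappa> r))"
      using smooth_on_has_derivative[OF D(2)] \<kappa>(1)[OF r] by blast
    then have "fd (\<lambda>r. X (\<kappa> r)) r = (\<lambda>v. fd X (\<kappa> r) (\<kappa>' v))"
      by (intro fd_eq has_derivative_compose[OF k(1)])
    moreover have "fd Z r = fd (\<lambda>r. X (\<kappa> r)) r"
      using \<kappa>(1) by (intro fd_cong_open[OF R(1) r]) auto
    ultimately show ?thesis
      using inj_compose[OF D(3) k(2), of "\<kappa> r"] \<kappa>(1)[OF r] by (simp add: comp_def)
  qed
  ultimately show ?thesis
    unfolding local_parametrization_def using R by blast
qed

lemma local_parametrization_subset:
  assumes "local_parametrization M X D" "open E" "E \<subseteq> D"
  shows "local_parametrization M X E"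
proof (rule local_parametrization_reparam[OF assms(1,2), where \<kappa> = "\<lambda>r. r"])
  show "smooth_on E X"
    using assms smooth_on_subset unfolding local_parametrization_def by blast
  show "\<exists>\<kappa>'. ((\<lambda>r. r) has_derivative \<kappa>') (at r) \<and> inj \<kappa>'" for r :: "real \<times> real"
    by (rule exI[of _ "\<lambda>r. r"]) (simp add: inj_on_def)
qed (use assms in auto)

lemma fd_in_tangent_space:
  assumes "local_parametrization M X D" "u \<in> D"
  shows "fd X u a \<in> tangent_space M (X u)"
proof -
  have D: "open D" "smooth_on D X" "openin (top_of_set M) (X ` D)"
    using local_parametrizationD[OF assms(1)] by blast+
  have "open ((\<lambda>t. u + t *\<^sub>R a) -` D)"
    by (intro open_vimage D continuous_intros)
  moreover have "0 \<in> (\<lambda>t. u + t *\<^sub>R a) -` D" using assms by simp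
  ultimately obtain e where e: "e > 0" "ball 0 e \<subseteq> (\<lambda>t. u + t *\<^sub>R a) -` D"
    using openE by blast
  have "ball 0 e = {-e<..<e}" by (simp add: ball_eq_greaterThanLessThan)
  with e have *: "u + t *\<^sub>R a \<in> D" if "t \<in> {-e<..<e}" for t using that by blast
  have "smooth_on {-e<..<e} (\<lambda>t. X (u + t *\<^sub>R a))"
    by (rule smooth_on_curve[OF D(2,1) _ *]) auto
  moreover have "((\<lambda>t. X (u + t *\<^sub>R a)) has_vector_derivative fd X u a) (at 0)"
    using curve_has_derivative[OF D(2), of u 0 a] assms by simp
  moreover have "X u \<in> M" if "u \<in> D" for u
    using openin_imp_subset[OF D(3)] that by blast
  ultimately show ?thesis
    using e(1) * unfolding tangent_space_def
    by (intro CollectI exI[of _ "\<lambda>t. X (u + t *\<^sub>R a)"] exI[of _ e] conjI image_subsetI) simp_all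
qed

lemma tangent_plane_surjective:
  fixes L :: "real \<times> real \<Rightarrow> real^3"
  assumes "linear L" "inj L" "n \<noteq> 0" "\<And>a. n \<bullet> L a = 0" "n \<bullet> x = 0"
  shows "\<exists>a. L a = x"
proof -
  have "dim (range L) = dim (UNIV :: (real \<times> real) set)"
    using dim_image_eq[OF assms(1)] assms(2) by simp
  then have "dim (range L) = dim {x. n \<bullet> x = 0}"
    using dim_hyperplane[OF assms(3)] by simp
  moreover have "range L \<subseteq> {x. n \<bullet> x = 0}" using assms(4) by auto
  moreover have "subspace (range L)" using assms(1) by (simp add: linear_subspace_image)
  ultimately have "range L = {x. n \<bullet> x = 0}"
    by (intro subspace_dim_equal subspace_hyperplane) simp_all
  then have "x \<in> range L" using assms(5) by simp
  then show ?thesis by (metis rangeE)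
qed

lemma frame_expansion:
  assumes "norm n = 1" "norm t = 1" "n \<bullet> t = 0"
  shows "x = (x \<bullet> n) *\<^sub>R n + (x \<bullet> t) *\<^sub>R t + (x \<bullet> cross3 n t) *\<^sub>R cross3 n t"
    and "norm (cross3 n t) = 1"
proof -
  have nt: "n \<bullet> n = 1" "t \<bullet> t = 1" "t \<bullet> n = 0"
    using assms by (simp_all add: norm_eq_1 inner_commute)
  show e: "norm (cross3 n t) = 1"
    using norm_cross[of n t] assms by (simp add: power2_eq_1_iff) (metis norm_ge_zero neg_0_le_iff_le not_one_le_zero)
  define z where "z = x - (x \<bullet> n) *\<^sub>R n - (x \<bullet> t) *\<^sub>R t"
  have z: "z \<bullet> n = 0" "z \<bullet> t = 0" "z \<bullet> cross3 n t = x \<bullet> cross3 n t"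
    using nt assms(3) by (simp_all add: z_def inner_diff_left dot_cross_self)
  have "cross3 (cross3 n t) z = 0"
    by (metis (no_types, lifting) Lagrange add.inverse_neutral cross_skew diff_zero scale_zero_left z(1,2))
  then have "0 = (cross3 n t \<bullet> z) *\<^sub>R cross3 n t - (cross3 n t \<bullet> cross3 n t) *\<^sub>R z"
    by (metis Lagrange cross_zero_right)
  then have "z = (x \<bullet> cross3 n t) *\<^sub>R cross3 n t"
    using e z(3) by (simp add: norm_eq_1 inner_commute)
  then show "x = (x \<bullet> n) *\<^sub>R n + (x \<bullet> t) *\<^sub>R t + (x \<bullet> cross3 n t) *\<^sub>R cross3 n t"
    by (simp add: z_def algebra_simps)
qed

lemma cross3_nonzero_if_inj:
  fixes L :: "real \<times> real \<Rightarrow> real^3"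
  assumes "linear L" "inj L"
  shows "cross3 (L (1,0)) (L (0,1)) \<noteq> 0"
proof
  assume "cross3 (L (1,0)) (L (0,1)) = 0"
  then have "L (1,0) = 0 \<or> L (0,1) = 0 \<or> (\<exists>c. L (0,1) = c *\<^sub>R L (1,0))"
    by (simp add: cross_eq_0 collinear_lemma)
  then have "L (1,0) = L 0 \<or> L (0,1) = L 0 \<or> (\<exists>c. L (0,1) = L (c *\<^sub>R (1,0)))"
    unfolding linear_0[OF assms(1)] linear_cmul[OF assms(1)] .
  then show False using assms(2) by (auto simp: inj_eq zero_prod_def)
qed

text \<open>A continuous unit normal field agrees, up to a sign that is constant near each point, with the
  normalized cross product of the coordinate fields.\<close>

lemma unit_normal_smooth_in_chart:
  assumes X: "local_parametrization M X D" and N: "unit_normal_field M N" and "u0 \<in> D"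
  obtains r where "r > 0" "ball u0 r \<subseteq> D" "smooth_on (ball u0 r) (\<lambda>u. N (X u))"
proof -
  have D: "open D" "smooth_on D X" "\<And>u. u \<in> D \<Longrightarrow> inj (fd X u)" "X ` D \<subseteq> M"
    using local_parametrizationD[OF X] by blast+
  have N': "continuous_on M N" "\<And>p. p \<in> M \<Longrightarrow> norm (N p) = 1"
    "\<And>p w. p \<in> M \<Longrightarrow> w \<in> tangent_space M p \<Longrightarrow> N p \<bullet> w = 0"
    using N by (auto simp: unit_normal_field_def)
  obtain r where r: "r > 0" "ball u0 r \<subseteq> D" using D(1) \<open>u0 \<in> D\<close> openE by blast
  define w where "w u = cross3 (fd X u (1,0)) (fd X u (0,1))" for u
  define \<nu> where "\<nu> u = sgn (w u)" for u
  have w: "w u \<noteq> 0" if "u \<in> D" for u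
    unfolding w_def by (intro cross3_nonzero_if_inj fd_linear[OF D(2)] D(3) that)
  have \<nu>: "smooth_on D \<nu>"
    unfolding \<nu>_def by (rule smooth_on_sgn[OF D(1) _ w]) (auto simp: w_def intro!: smooth_intros D)
  have n\<nu>: "N (X u) = (N (X u) \<bullet> \<nu> u) *\<^sub>R \<nu> u" "(N (X u) \<bullet> \<nu> u)\<^sup>2 = 1" if u: "u \<in> D" for u
  proof -
    have "cross3 (N (X u)) (w u) = 0"
      unfolding w_def Lagrange
      using N'(3)[OF _ fd_in_tangent_space[OF X u]] D(4) u by auto
    then have "cross3 (w u) (N (X u)) = 0"
      using cross_skew[of "w u"] by simp
    then have c: "cross3 (\<nu> u) (N (X u)) = 0"
      by (simp add: \<nu>_def sgn_div_norm cross_mult_left)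
    have "\<nu> u \<bullet> \<nu> u = 1" using w[OF u] by (simp add: \<nu>_def norm_sgn flip: norm_eq_1)
    then show eq: "N (X u) = (N (X u) \<bullet> \<nu> u) *\<^sub>R \<nu> u"
      using Lagrange[of "\<nu> u" "\<nu> u" "N (X u)"] c by (simp add: inner_commute)
    have "norm (N (X u)) = 1" using N'(2) D(4) u by blast
    then show "(N (X u) \<bullet> \<nu> u)\<^sup>2 = 1"
      using norm_sgn[of "w u"] w[OF u] arg_cong[OF eq, of norm] by (simp add: \<nu>_def abs_square_eq_1)
  qed
  have "continuous_on (ball u0 r) (\<lambda>u. N (X u))"
    using continuous_on_compose2[OF N'(1) smooth_on_continuous[OF D(2)] D(4)] r(2) continuous_on_subset by blast
  then have "continuous_on (ball u0 r) (\<lambda>u. N (X u) \<bullet> \<nu> u)"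
    using smooth_on_continuous[OF \<nu>] continuous_on_subset[OF _ r(2)] by (intro continuous_on_inner) auto
  moreover have "(\<lambda>u. N (X u) \<bullet> \<nu> u) ` ball u0 r \<subseteq> {1, -1}"
    using n\<nu>(2) r(2) by (auto simp: power2_eq_1_iff)
  ultimately have "(\<lambda>u. N (X u) \<bullet> \<nu> u) constant_on ball u0 r"
    by (intro continuous_finite_range_constant) (auto intro: finite_subset)
  then obtain \<sigma> where "\<And>u. u \<in> ball u0 r \<Longrightarrow> N (X u) \<bullet> \<nu> u = \<sigma>"
    unfolding constant_on_def by blast
  then have "\<sigma> *\<^sub>R \<nu> u = N (X u)" if "u \<in> ball u0 r" for u
    using n\<nu>(1)[of u] r(2) that by auto
  moreover have "smooth_on (ball u0 r) (\<lambda>u. \<sigma> *\<^sub>R \<nu> u)"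
    by (intro smooth_on_scaleR smooth_on_const open_ball smooth_on_subset[OF \<nu> r(2)])
  ultimately have "smooth_on (ball u0 r) (\<lambda>u. N (X u))"
    using smooth_on_cong[of "ball u0 r" "\<lambda>u. \<sigma> *\<^sub>R \<nu> u" "\<lambda>u. N (X u)"] open_ball by blast
  then show ?thesis using that r by blast
qed

text \<open>A regular surface inside a plane or a sphere is open in it: thickening a chart in the normal
  direction gives an injective continuous map between open sets of the same dimension, to which
  invariance of domain applies.\<close>

lemma openin_plane_if_regular:
  assumes "regular_surface M" "a \<noteq> 0" "M \<subseteq> {x. a \<bullet> x = b}"
  shows "openin (top_of_set {x. a \<bullet> x = b}) M"
proof (subst openin_subopen, intro ballI)
  fix p assume "p \<in> M"
  then obtain X D where X: "local_parametrization M X D" "p \<in> X ` D"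
    using assms(1) by (auto simp: regular_surface_def)
  have D: "open D" "continuous_on D X" "X ` D \<subseteq> M" "inj_on X D"
    using local_parametrizationD[OF X(1)] by blast+
  have lev: "a \<bullet> X u = b" if "u \<in> D" for u using D(3) assms(3) that by blast
  define G where "G = (\<lambda>w. X (fst w) + snd w *\<^sub>R a)"
  have aG: "a \<bullet> G w = b + snd w * (a \<bullet> a)" if "w \<in> D \<times> UNIV" for w
    using that lev by (auto simp: G_def inner_add_right)
  have "open (G ` (D \<times> UNIV))"
  proof (rule invariance_of_domain_gen)
    show "open (D \<times> (UNIV :: real set))" using D(1) by (simp add: open_Times)
    show "continuous_on (D \<times> UNIV) G" unfolding G_def
      by (intro continuous_intros continuous_on_compose2[OF D(2)]) auto
    show "inj_on G (D \<times> UNIV)"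
    proof (rule inj_onI)
      fix w w' assume w: "w \<in> D \<times> UNIV" "w' \<in> D \<times> UNIV" "G w = G w'"
      then have "snd w = snd w'"
        using aG[of w] aG[of w'] assms(2) by simp
      moreover from this have "X (fst w) = X (fst w')" using w(3) by (simp add: G_def)
      then have "fst w = fst w'" using D(4) w by (auto dest: inj_onD)
      ultimately show "w = w'" by (simp add: prod_eq_iff)
    qed
  qed simp
  moreover have "X ` D = {x. a \<bullet> x = b} \<inter> G ` (D \<times> UNIV)"
  proof (intro equalityI subsetI)
    fix x assume "x \<in> X ` D"
    then obtain u where u: "u \<in> D" "x = G (u, 0)" by (auto simp: G_def)
    then show "x \<in> {x. a \<bullet> x = b} \<inter> G ` (D \<times> UNIV)"
      using aG[of "(u, 0)"] by auto
  next
    fix x assume "x \<in> {x. a \<bullet> x = b} \<inter> G ` (D \<times> UNIV)"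
    then obtain w where w: "w \<in> D \<times> UNIV" "x = G w" "a \<bullet> G w = b" by auto
    then have "snd w = 0" using aG[OF w(1)] assms(2) by simp
    then show "x \<in> X ` D" using w by (auto simp: G_def)
  qed
  ultimately have "openin (top_of_set {x. a \<bullet> x = b}) (X ` D)"
    by (metis openin_open)
  then show "\<exists>T. openin (top_of_set {x. a \<bullet> x = b}) T \<and> p \<in> T \<and> T \<subseteq> M"
    using X D by blast
qed

lemma openin_sphere_if_regular:
  assumes "regular_surface M" "r > 0" "M \<subseteq> sphere c r"
  shows "openin (top_of_set (sphere c r)) M"
proof (subst openin_subopen, intro ballI)
  fix p assume "p \<in> M"
  then obtain X D where X: "local_parametrization M X D" "p \<in> X ` D"
    using assms(1) by (auto simp: regular_surface_def)
  have D: "open D" "continuous_on D X" "X ` D \<subseteq> M" "inj_on X D"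
    using local_parametrizationD[OF X(1)] by blast+
  have lev: "norm (X u - c) = r" if "u \<in> D" for u
  proof -
    have "X u \<in> sphere c r" using D(3) assms(3) that by blast
    then show ?thesis by (simp add: dist_norm norm_minus_commute)
  qed
  define G where "G = (\<lambda>w. c + snd w *\<^sub>R (X (fst w) - c))"
  have aG: "dist c (G w) = snd w * r" if "w \<in> D \<times> {0<..}" for w
    using that lev by (auto simp: G_def dist_norm)
  have "open (G ` (D \<times> {0<..}))"
  proof (rule invariance_of_domain_gen)
    show "open (D \<times> {0::real<..})" using D(1) by (simp add: open_Times)
    show "continuous_on (D \<times> {0<..}) G" unfolding G_def
      by (intro continuous_intros continuous_on_compose2[OF D(2)]) auto
    show "inj_on G (D \<times> {0<..})"
    proof (rule inj_onI)
      fix w w' assume w: "w \<in> D \<times> {0<..}" "w' \<in> D \<times> {0<..}" "G w = G w'"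
      then have s: "snd w = snd w'"
        using aG[of w] aG[of w'] assms(2) by simp
      moreover from s have "X (fst w) = X (fst w')" using w by (auto simp: G_def)
      then have "fst w = fst w'" using D(4) w by (auto dest: inj_onD)
      ultimately show "w = w'" by (simp add: prod_eq_iff)
    qed
  qed simp
  moreover have "X ` D = sphere c r \<inter> G ` (D \<times> {0<..})"
  proof (intro equalityI subsetI)
    fix x assume "x \<in> X ` D"
    then obtain u where u: "u \<in> D" "x = G (u, 1)" by (auto simp: G_def)
    then show "x \<in> sphere c r \<inter> G ` (D \<times> {0<..})"
      using aG[of "(u, 1)"] by auto
  next
    fix x assume "x \<in> sphere c r \<inter> G ` (D \<times> {0<..})"
    then obtain w where w: "w \<in> D \<times> {0<..}" "x = G w" "dist c (G w) = r" by auto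
    then have "snd w = 1" using aG[OF w(1)] assms(2) by simp
    then show "x \<in> X ` D" using w by (auto simp: G_def)
  qed
  ultimately have "openin (top_of_set (sphere c r)) (X ` D)"
    by (metis openin_open)
  then show "\<exists>T. openin (top_of_set (sphere c r)) T \<and> p \<in> T \<and> T \<subseteq> M"
    using X D by blast
qed

section \<open>Rulings\<close>

lemma smooth_on_Pair:
  fixes f g :: "'a::euclidean_space \<Rightarrow> real"
  assumes "open U" "smooth_on U f" "smooth_on U g"
  shows "smooth_on U (\<lambda>x. (f x, g x))"
proof -
  have "(\<lambda>x. (f x, g x)) = (\<lambda>x. f x *\<^sub>R (1,0) + g x *\<^sub>R (0,1))" by auto
  then show ?thesis by (simp only:) (intro smooth_intros assms)
qed

lemma fd_Pair:
  assumes "smooth_on U f" "smooth_on U g" "x \<in> U"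
  shows "fd (\<lambda>x. (f x, g x)) x v = (fd f x v, fd g x v)"
  using fd_eq[OF has_derivative_Pair[OF smooth_on_has_derivative smooth_on_has_derivative]] assms by metis

lemma ex_transversal_direction:
  fixes L :: "real \<times> real \<Rightarrow> 'a::real_inner"
  assumes "linear L" "inj L" "L W \<noteq> 0"
  shows "\<exists>w. L w \<noteq> 0 \<and> L w \<bullet> L W = 0"
proof -
  let ?a = "L (1,0)" and ?b = "L (0,1)" and ?e = "L W"
  define w where "w = (?b \<bullet> ?e, - (?a \<bullet> ?e))"
  have L: "L v = fst v *\<^sub>R ?a + snd v *\<^sub>R ?b" for v
  proof -
    have "L (fst v *\<^sub>R (1,0) + snd v *\<^sub>R (0,1)) = fst v *\<^sub>R ?a + snd v *\<^sub>R ?b"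
      by (simp only: linear_add[OF assms(1)] linear_cmul[OF assms(1)])
    then show ?thesis by simp
  qed
  have "L w \<bullet> ?e = 0"
    by (subst L[of w]) (simp add: w_def inner_diff_left)
  moreover have "L w \<noteq> 0"
  proof
    assume "L w = 0"
    then have "w = 0" using assms(1,2) by (metis injD linear_0)
    then have "?a \<bullet> ?e = 0" "?b \<bullet> ?e = 0" by (auto simp: w_def zero_prod_def)
    then have "?e \<bullet> ?e = 0"
      by (subst L[of W]) (simp add: inner_add_left)
    then show False using assms(3) by simp
  qed
  ultimately show ?thesis by blast
qed

text \<open>Here \<open>e\<close> is a unit tangent field that is parallel along its own direction, so its integral curves
  ought to be straight segments, with arc length \<open>s\<close>. No differential equation has to be solved to see
  this. The point \<open>h u = X u - s u *\<^sub>R e u\<close>, where the ruling through \<open>X u\<close> meets the curve \<open>s = 0\<close>, has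
  derivative \<open>0\<close> in the direction of \<open>e\<close>, as has \<open>e\<close> itself, while \<open>h\<close> has a nonzero derivative in the
  other direction. Hence a component of \<open>h\<close> together with \<open>s\<close> are local coordinates in which \<open>h\<close> and \<open>e\<close>
  depend on the first coordinate only.\<close>

lemma ruled_parametrization:
  assumes X: "local_parametrization M X D" and "u0 \<in> D"
    and e: "smooth_on D e" "\<And>u. u \<in> D \<Longrightarrow> norm (e u) = 1"
    and s: "smooth_on D s" "s u0 = 0" "\<And>u a. u \<in> D \<Longrightarrow> fd s u a = fd X u a \<bullet> e u"
    and ruling: "\<And>u. u \<in> D \<Longrightarrow> \<exists>W. fd X u W = e u \<and> fd e u W = 0"
  obtains \<epsilon> w where "\<epsilon> > 0" "\<forall>\<sigma>\<in>{-\<epsilon><..<\<epsilon>}. u0 + \<sigma> *\<^sub>R w \<in> D"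
    "local_parametrization M
       (\<lambda>(\<sigma>, z). X (u0 + \<sigma> *\<^sub>R w) - s (u0 + \<sigma> *\<^sub>R w) *\<^sub>R e (u0 + \<sigma> *\<^sub>R w) + z *\<^sub>R e (u0 + \<sigma> *\<^sub>R w))
       ({-\<epsilon><..<\<epsilon>} \<times> {-\<epsilon><..<\<epsilon>})"
proof -
  note D = local_parametrizationD[OF X]
  define h where "h u = X u - s u *\<^sub>R e u" for u
  have h: "smooth_on D h" unfolding h_def by (intro smooth_intros D e s)
  have dh: "fd h u a = fd X u a - (s u *\<^sub>R fd e u a + fd s u a *\<^sub>R e u)" if "u \<in> D" for u a
    unfolding h_def
    by (simp add: fd_diff[OF D(2) smooth_on_scaleR[OF D(1) s(1) e(1)] that]
        fd_scaleR[OF s(1) e(1) that])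
  have lin: "linear (fd f u)" if "smooth_on D f" "u \<in> D" for f :: "real \<times> real \<Rightarrow> 'z::real_normed_vector" and u
    by (rule fd_linear[OF that])
  define W where "W u = (SOME W. fd X u W = e u \<and> fd e u W = 0)" for u
  have W: "fd X u (W u) = e u" "fd e u (W u) = 0" if "u \<in> D" for u
    using someI_ex[OF ruling[OF that]] by (auto simp: W_def)
  have sW: "fd s u (W u) = 1" if "u \<in> D" for u
    using s(3)[OF that] W(1)[OF that] e(2)[OF that] by (simp add: norm_eq_1)
  have hW: "fd h u (W u) = 0" if "u \<in> D" for u
    using dh[OF that] sW[OF that] W[OF that] by simp
  have "fd X u0 (W u0) \<noteq> 0" using W(1)[OF \<open>u0 \<in> D\<close>] e(2)[OF \<open>u0 \<in> D\<close>] by auto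
  then obtain w where w: "fd X u0 w \<noteq> 0" "fd X u0 w \<bullet> e u0 = 0"
    using ex_transversal_direction[OF lin[OF D(2) \<open>u0 \<in> D\<close>] D(3)[OF \<open>u0 \<in> D\<close>]] W(1)[OF \<open>u0 \<in> D\<close>] by metis
  define a where "a = fd X u0 w"
  have hw: "fd h u0 w = a" "fd s u0 w = 0"
    using dh[OF \<open>u0 \<in> D\<close>] s(2,3) \<open>u0 \<in> D\<close> w by (simp_all add: a_def)
  have aa: "a \<bullet> a > 0" using w by (simp add: a_def)
  define \<Phi> where "\<Phi> u = (h u \<bullet> a, s u)" for u
  have \<Phi>: "smooth_on D \<Phi>" unfolding \<Phi>_def
    by (intro smooth_on_Pair smooth_intros D h s)
  have d\<Phi>: "fd \<Phi> u v = (fd h u v \<bullet> a, fd s u v)" if "u \<in> D" for u v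
    unfolding \<Phi>_def
    by (simp add: fd_Pair[OF smooth_on_inner[OF D(1) h smooth_on_const[OF D(1)]] s(1) that]
        fd_inner_const[OF h that])
  have "surj (fd \<Phi> u0)"
  proof (rule surjI)
    fix q :: "real \<times> real"
    let ?v = "(fst q / (a \<bullet> a)) *\<^sub>R w + snd q *\<^sub>R W u0"
    have "fd h u0 ?v = (fst q / (a \<bullet> a)) *\<^sub>R a" "fd s u0 ?v = snd q"
      using hw hW[OF \<open>u0 \<in> D\<close>] sW[OF \<open>u0 \<in> D\<close>]
      by (simp_all add: linear_add[OF lin[OF h \<open>u0 \<in> D\<close>]] linear_cmul[OF lin[OF h \<open>u0 \<in> D\<close>]]
          linear_add[OF lin[OF s(1) \<open>u0 \<in> D\<close>]] linear_cmul[OF lin[OF s(1) \<open>u0 \<in> D\<close>]])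
    then show "fd \<Phi> u0 ?v = q"
      using aa by (simp add: d\<Phi>[OF \<open>u0 \<in> D\<close>] prod_eq_iff)
  qed
  then have "inj (fd \<Phi> u0)"
    using linear_surj_imp_inj[OF lin[OF \<Phi> \<open>u0 \<in> D\<close>]] by blast
  then obtain U V \<Psi> where U: "open U" "U \<subseteq> D" "u0 \<in> U" and V: "open V"
    and hom: "homeomorphism U V \<Phi> \<Psi>"
    and \<Psi>: "\<And>y. y \<in> V \<Longrightarrow> \<exists>g'. (\<Psi> has_derivative g') (at y) \<and>
       (\<forall>k. fd \<Phi> (\<Psi> y) (g' k) = k) \<and> (\<forall>k. g' (fd \<Phi> (\<Psi> y) k) = k)"
    using smooth_inverse_function[OF D(1) \<Phi> \<open>u0 \<in> D\<close>] by metis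
  have \<Psi>U: "\<Psi> y \<in> U" "\<Phi> (\<Psi> y) = y" if "y \<in> V" for y
    using hom that homeomorphism_image2 homeomorphism_apply2 by blast+
  have \<Phi>V: "\<Phi> u \<in> V" "\<Psi> (\<Phi> u) = u" if "u \<in> U" for u
    using hom that homeomorphism_image1 homeomorphism_apply1 by blast+
  obtain A B where AB: "open A" "open B" "\<Phi> u0 \<in> A \<times> B" "A \<times> B \<subseteq> V"
    using open_prod_elim[OF V \<Phi>V(1)[OF U(3)]] by blast
  then obtain \<delta> where \<delta>: "\<delta> > 0" "ball 0 \<delta> \<subseteq> B"
    using openE[OF AB(2), of 0] s(2) by (auto simp: \<Phi>_def)
  \<comment> \<open>In the coordinates \<open>\<Phi>\<close> the direction of \<open>e\<close> is that of the second coordinate.\<close>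
  have const: "f (\<Psi> (\<tau>, z)) = f (\<Psi> (\<tau>, z'))"
    if f: "smooth_on D f" "\<And>u. u \<in> D \<Longrightarrow> fd f u (W u) = 0" and "\<tau> \<in> A" "z \<in> ball 0 \<delta>" "z' \<in> ball 0 \<delta>"
    for f :: "real \<times> real \<Rightarrow> real^3" and \<tau> z z'
  proof (rule has_derivative_zero_unique[OF convex_ball _ that(4,5)])
    fix z :: real assume "z \<in> ball 0 \<delta>"
    then have yV: "(\<tau>, z) \<in> V" using AB(4) \<delta>(2) \<open>\<tau> \<in> A\<close> by blast
    let ?u = "\<Psi> (\<tau>, z)"
    have u: "?u \<in> D" using \<Psi>U(1)[OF yV] U(2) by blast
    obtain g' where g': "(\<Psi> has_derivative g') (at (\<tau>, z))" "\<And>k. g' (fd \<Phi> ?u k) = k"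
      using \<Psi>[OF yV] by blast
    have "g' (0, 1) = W ?u"
      using g'(2)[of "W ?u"] by (simp add: d\<Phi>[OF u] hW[OF u] sW[OF u])
    moreover have "(0, t) = t *\<^sub>R (0, 1 :: real)" for t :: real by simp
    ultimately have g0: "g' (0, t) = t *\<^sub>R W ?u" for t
      using linear_cmul[OF has_derivative_linear[OF g'(1)]] by metis
    have "((\<lambda>z. (\<tau>, z)) has_derivative (\<lambda>t. (0, t))) (at z)"
      by (auto intro!: derivative_eq_intros)
    from has_derivative_compose[OF has_derivative_compose[OF this g'(1)] smooth_on_has_derivative[OF f(1) u]]
    have "((\<lambda>z. f (\<Psi> (\<tau>, z))) has_derivative (\<lambda>t. fd f ?u (t *\<^sub>R W ?u))) (at z)"
      by (simp only: g0)
    then have "((\<lambda>z. f (\<Psi> (\<tau>, z))) has_derivative (\<lambda>t. 0)) (at z)"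
      by (simp add: linear_cmul[OF lin[OF f(1) u]] f(2)[OF u])
    then show "((\<lambda>z. f (\<Psi> (\<tau>, z))) has_derivative (\<lambda>t. 0)) (at z within ball 0 \<delta>)"
      by (rule has_derivative_at_withinI)
  qed
  define \<gamma> where "\<gamma> \<sigma> = u0 + \<sigma> *\<^sub>R w" for \<sigma>
  define \<theta> where "\<theta> \<sigma> = h (\<gamma> \<sigma>) \<bullet> a" for \<sigma>
  define E where "E = {u \<in> U. \<Phi> u \<in> A \<times> ball 0 \<delta> \<and> fd h u w \<bullet> a \<in> {0<..}}"
  have "open E"
  proof -
    have "continuous_on U \<Phi>" "continuous_on U (\<lambda>u. fd h u w \<bullet> a)"
      using smooth_on_continuous[OF \<Phi>] smooth_on_continuous[OF smooth_on_inner[OF D(1) smooth_on_fd[OF h] smooth_on_const[OF D(1)]]]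
        continuous_on_subset[OF _ U(2)] by blast+
    then have "open (U \<inter> \<Phi> -` (A \<times> ball 0 \<delta>))" "open (U \<inter> (\<lambda>u. fd h u w \<bullet> a) -` {0<..})"
      using AB(1) U(1) by (auto intro!: continuous_open_preimage open_Times)
    moreover have "E = (U \<inter> \<Phi> -` (A \<times> ball 0 \<delta>)) \<inter> (U \<inter> (\<lambda>u. fd h u w \<bullet> a) -` {0<..})"
      unfolding E_def by blast
    ultimately show ?thesis by (simp add: open_Int)
  qed
  then have "open (\<gamma> -` E)"
    unfolding \<gamma>_def by (intro open_vimage continuous_intros)
  moreover have "0 \<in> \<gamma> -` E"
    using U(3) AB(3) \<delta>(1) s(2) hw(1) aa by (auto simp: E_def \<gamma>_def \<Phi>_def)
  ultimately obtain \<epsilon>0 where \<epsilon>0: "\<epsilon>0 > 0" "ball 0 \<epsilon>0 \<subseteq> \<gamma> -` E" using openE by blast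
  define \<epsilon> where "\<epsilon> = min \<epsilon>0 \<delta>"
  let ?I = "{-\<epsilon><..<\<epsilon>}"
  have \<epsilon>: "\<epsilon> > 0" "\<And>\<sigma>. \<sigma> \<in> ?I \<Longrightarrow> \<gamma> \<sigma> \<in> E" "\<And>z. z \<in> ?I \<Longrightarrow> z \<in> ball 0 \<delta>"
    using \<epsilon>0 \<delta>(1) by (auto simp: \<epsilon>_def subset_iff abs_less_iff)
  have \<gamma>D: "\<gamma> \<sigma> \<in> D" if "\<sigma> \<in> ?I" for \<sigma> using \<epsilon>(2)[OF that] U(2) by (auto simp: E_def)
  have d\<theta>: "(\<theta> has_real_derivative fd h (\<gamma> \<sigma>) w \<bullet> a) (at \<sigma>)" if "\<sigma> \<in> ?I" for \<sigma>
    using curve_has_derivative[OF smooth_on_inner[OF D(1) h smooth_on_const[OF D(1), of a]], of u0 \<sigma> w]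
      \<gamma>D[OF that] fd_inner_const[OF h \<gamma>D[OF that]]
    by (simp add: has_real_derivative_iff_has_vector_derivative \<theta>_def[abs_def] \<gamma>_def)
  have \<theta>: "\<theta> \<sigma> \<in> A" "fd h (\<gamma> \<sigma>) w \<bullet> a > 0" if "\<sigma> \<in> ?I" for \<sigma>
    using \<epsilon>(2)[OF that] by (auto simp: E_def \<Phi>_def \<theta>_def)
  have mono: "\<theta> \<sigma> < \<theta> \<sigma>'" if "\<sigma> \<in> ?I" "\<sigma>' \<in> ?I" "\<sigma> < \<sigma>'" for \<sigma> \<sigma>'
  proof (rule DERIV_pos_imp_increasing[OF that(3)])
    fix x assume "\<sigma> \<le> x" "x \<le> \<sigma>'"
    then have "x \<in> ?I" using that by auto
    then show "\<exists>y. (\<theta> has_real_derivative y) (at x) \<and> y > 0" using d\<theta> \<theta>(2) by blast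
  qed
  define \<kappa> where "\<kappa> r = \<Psi> (\<theta> (fst r), snd r)" for r
  have \<kappa>V: "(\<theta> (fst r), snd r) \<in> V" if "r \<in> ?I \<times> ?I" for r
    using \<theta>(1) \<epsilon>(3) \<delta>(2) AB(4) that by (auto simp: mem_Times_iff subset_iff)
  have "local_parametrization M (\<lambda>(\<sigma>, z). h (\<gamma> \<sigma>) + z *\<^sub>R e (\<gamma> \<sigma>)) (?I \<times> ?I)"
  proof (rule local_parametrization_reparam[OF X])
    show op: "open (?I \<times> ?I)" by (simp add: open_Times)
    have sm: "smooth_on (?I \<times> ?I) (\<lambda>r. f (\<gamma> (fst r)))" if "smooth_on D f" for f :: "real \<times> real \<Rightarrow> real^3"
    proof (rule smooth_on_compose[of ?I "\<lambda>t. f (\<gamma> t)" "?I \<times> ?I" fst])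
      show "smooth_on ?I (\<lambda>t. f (\<gamma> t))"
        unfolding \<gamma>_def by (rule smooth_on_curve[OF that D(1)]) (use \<gamma>D in \<open>auto simp: \<gamma>_def\<close>)
      show "smooth_on (?I \<times> ?I) fst" by (rule smooth_on_linear[OF op bounded_linear_fst])
    qed (use op in auto)
    have "smooth_on (?I \<times> ?I) (\<lambda>r. h (\<gamma> (fst r)) + snd r *\<^sub>R e (\<gamma> (fst r)))"
      by (intro smooth_on_add smooth_on_scaleR sm h e op smooth_on_linear[OF op bounded_linear_snd])
    then show "smooth_on (?I \<times> ?I) (\<lambda>(\<sigma>, z). h (\<gamma> \<sigma>) + z *\<^sub>R e (\<gamma> \<sigma>))"
      by (simp add: case_prod_unfold)
    show "inj_on \<kappa> (?I \<times> ?I)"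
    proof (rule inj_onI)
      fix r r' assume r: "r \<in> ?I \<times> ?I" "r' \<in> ?I \<times> ?I" "\<kappa> r = \<kappa> r'"
      have fst: "fst r \<in> ?I" "fst r' \<in> ?I" using r(1,2) by (simp_all only: mem_Times_iff)
      have eq: "\<theta> (fst r) = \<theta> (fst r')" "snd r = snd r'"
        using arg_cong[OF r(3), of \<Phi>] \<Psi>U(2)[OF \<kappa>V[OF r(1)]] \<Psi>U(2)[OF \<kappa>V[OF r(2)]]
        by (simp_all add: \<kappa>_def)
      then have "fst r = fst r'"
        using mono[OF fst] mono[OF fst(2,1)] by (metis less_irrefl linorder_neqE)
      with eq(2) show "r = r'" by (rule prod_eqI[rotated])
    qed
    fix r assume r: "r \<in> ?I \<times> ?I"
    then have \<sigma>: "fst r \<in> ?I" and z: "snd r \<in> ?I" by (auto simp: mem_Times_iff)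
    have uE: "\<gamma> (fst r) \<in> U" "s (\<gamma> (fst r)) \<in> ball 0 \<delta>"
      using \<epsilon>(2)[OF \<sigma>] by (auto simp: E_def \<Phi>_def)
    have \<kappa>D: "\<kappa> r \<in> D" using \<Psi>U(1)[OF \<kappa>V[OF r]] U(2) by (auto simp: \<kappa>_def)
    have "\<gamma> (fst r) = \<Psi> (\<theta> (fst r), s (\<gamma> (fst r)))"
      using \<Phi>V(2)[OF uE(1)] by (simp add: \<Phi>_def \<theta>_def)
    then have "h (\<kappa> r) = h (\<gamma> (fst r))" "e (\<kappa> r) = e (\<gamma> (fst r))"
      using const[OF h hW \<theta>(1)[OF \<sigma>] \<epsilon>(3)[OF z] uE(2)] const[OF e(1) W(2) \<theta>(1)[OF \<sigma>] \<epsilon>(3)[OF z] uE(2)]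
      by (simp_all add: \<kappa>_def)
    moreover have "s (\<kappa> r) = snd r"
      using \<Psi>U(2)[OF \<kappa>V[OF r]] by (simp add: \<kappa>_def \<Phi>_def)
    moreover have "X (\<kappa> r) = h (\<kappa> r) + s (\<kappa> r) *\<^sub>R e (\<kappa> r)" by (simp add: h_def)
    ultimately show "\<kappa> r \<in> D \<and> (case r of (\<sigma>, z) \<Rightarrow> h (\<gamma> \<sigma>) + z *\<^sub>R e (\<gamma> \<sigma>)) = X (\<kappa> r)"
      using \<kappa>D by (simp add: case_prod_unfold)
    obtain g' where g': "(\<Psi> has_derivative g') (at (\<theta> (fst r), snd r))"
        "\<And>k. fd \<Phi> (\<Psi> (\<theta> (fst r), snd r)) (g' k) = k"
      using \<Psi>[OF \<kappa>V[OF r]] by blast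
    let ?c = "fd h (\<gamma> (fst r)) w \<bullet> a"
    have "((\<lambda>r. \<theta> (fst r)) has_derivative (\<lambda>v. ?c * fst v)) (at r)"
      using has_derivative_compose[OF has_derivative_fst[OF has_derivative_ident] d\<theta>[OF \<sigma>, unfolded has_field_derivative_def]] .
    then have "((\<lambda>r. (\<theta> (fst r), snd r)) has_derivative (\<lambda>v. (?c * fst v, snd v))) (at r)"
      by (intro has_derivative_Pair has_derivative_snd[OF has_derivative_ident])
    from has_derivative_compose[OF this g'(1)]
    have "(\<kappa> has_derivative (\<lambda>v. g' (?c * fst v, snd v))) (at r)" by (simp add: \<kappa>_def[abs_def])
    moreover have "inj (\<lambda>v. g' (?c * fst v, snd v))"
    proof (rule injI)
      fix v v' assume "g' (?c * fst v, snd v) = g' (?c * fst v', snd v')"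
      then have "(?c * fst v, snd v) = (?c * fst v', snd v')" using g'(2) by metis
      then show "v = v'" using \<theta>(2)[OF \<sigma>] by (simp add: prod_eq_iff)
    qed
    ultimately show "\<exists>\<kappa>'. (\<kappa> has_derivative \<kappa>') (at r) \<and> inj \<kappa>'" by blast
  qed
  then show ?thesis
    using \<epsilon>(1) \<gamma>D that[of \<epsilon> w] unfolding h_def \<gamma>_def by blast
qed

section \<open>Arc length and the Darboux frame\<close>

lemma curve_in_tangent_space:
  fixes \<gamma> :: "real \<Rightarrow> real^3"
  assumes "open I" "smooth_on I \<gamma>" "\<And>t. t \<in> I \<Longrightarrow> \<gamma> t \<in> S" "t0 \<in> I"
  shows "fd \<gamma> t0 1 \<in> tangent_space S (\<gamma> t0)"
proof -
  obtain e where e: "e > 0" "ball t0 e \<subseteq> I" using assms(1,4) openE by blast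
  have *: "t0 + t *\<^sub>R 1 \<in> I" if "t \<in> {-e<..<e}" for t
  proof -
    have "t0 + t \<in> ball t0 e" using that by (auto simp: dist_real_def)
    then show ?thesis using e(2) by auto
  qed
  have "smooth_on {-e<..<e} (\<lambda>t. \<gamma> (t0 + t *\<^sub>R 1))"
    by (rule smooth_on_curve[OF assms(2,1) _ *]) auto
  moreover have "((\<lambda>t. \<gamma> (t0 + t *\<^sub>R 1)) has_vector_derivative fd \<gamma> t0 1) (at 0)"
    using curve_has_derivative[OF assms(2), of t0 0 1] assms(4) by simp
  ultimately show ?thesis
    using e(1) * assms(3) unfolding tangent_space_def
    by (intro CollectI exI[of _ "\<lambda>t. \<gamma> (t0 + t *\<^sub>R 1)"] exI[of _ e] conjI image_subsetI) simp_all
qed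

lemma smooth_on_real_has_derivative:
  assumes "smooth_on I f" "t \<in> I"
  shows "(f has_vector_derivative fd f t 1) (at t)"
  using curve_has_derivative[OF assms(1), of 0 t 1] assms(2) by simp

text \<open>Bootstrapping: the equation \<open>g' = f \<circ> g\<close> turns every order of differentiability of \<open>g\<close> into one
  more.\<close>

lemma smooth_solution_autonomous:
  fixes g f :: "real \<Rightarrow> real"
  assumes "open J" "open K" "smooth_on K f" "g ` J \<subseteq> K"
    "\<And>t. t \<in> J \<Longrightarrow> (g has_real_derivative f (g t)) (at t)"
  shows "smooth_on J g"
  unfolding smooth_on_def
proof
  fix k
  show "Ck_on k g J"
  proof (induction k)
    case 0
    show ?case
      using assms(5) by (auto intro!: continuous_at_imp_continuous_on DERIV_isCont)
  next
    case (Suc k)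
    have "Ck_on k f K" using assms(3) by (simp add: smooth_on_def)
    then have "Ck_on k (\<lambda>t. f (g t)) J"
      by (rule Ck_on_compose[OF assms(1,2,4) _ Suc])
    then have "Ck_on k (\<lambda>t. f (g t) * v) J" for v
      by (rule Ck_on_bilinear[OF bounded_bilinear_mult assms(1) _ Ck_on_const[OF assms(1)]])
    then show ?case
      using assms(5)
      by (intro Ck_on_SucI[OF assms(1), where f' = "\<lambda>t v. f (g t) * v"]) (simp add: has_field_derivative_def)
  qed
qed

text \<open>\<open>g\<close> inverts the arc length, measured from \<open>0\<close> and counted with the sign \<open>\<sigma>\<close>, which
  decides about the orientation of the reparametrized curve.\<close>

lemma arclength_parameter:
  fixes \<gamma> :: "real \<Rightarrow> 'a::euclidean_space"
  assumes "\<epsilon> > 0" "smooth_on {-\<epsilon><..<\<epsilon>} \<gamma>" "\<And>t. t \<in> {-\<epsilon><..<\<epsilon>} \<Longrightarrow> fd \<gamma> t 1 \<noteq> 0" "\<sigma>\<^sup>2 = (1::real)"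
  obtains \<delta> g where "\<delta> > 0" "g 0 = 0" "smooth_on {-\<delta><..<\<delta>} g" "g ` {-\<delta><..<\<delta>} \<subseteq> {-\<epsilon><..<\<epsilon>}"
    "inj_on g {-\<delta><..<\<delta>}"
    "\<And>t. t \<in> {-\<delta><..<\<delta>} \<Longrightarrow> (g has_real_derivative \<sigma> / norm (fd \<gamma> (g t) 1)) (at t)"
proof -
  let ?K = "{-\<epsilon>/2<..<\<epsilon>/2}"
  define f where "f t = \<sigma> * norm (fd \<gamma> t 1)" for t
  have \<sigma>: "\<sigma> \<noteq> 0" "\<sigma> * \<sigma> = 1" using assms(4) by (auto simp: power2_eq_square)
  have f: "smooth_on {-\<epsilon><..<\<epsilon>} f"
    unfolding f_def by (intro smooth_on_mult smooth_on_const smooth_on_norm smooth_on_fd assms(2,3)) auto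
  have f0: "f t \<noteq> 0" if "t \<in> {-\<epsilon><..<\<epsilon>}" for t using assms(3)[OF that] \<sigma> by (simp add: f_def)
  define l where "l t = integral {-\<epsilon>/2..t} f - integral {-\<epsilon>/2..0} f" for t
  have K: "?K \<subseteq> {-\<epsilon><..<\<epsilon>}" "{-\<epsilon>/2..\<epsilon>/2} \<subseteq> {-\<epsilon><..<\<epsilon>}" "open ?K" using assms(1) by auto
  have dl: "(l has_real_derivative f t) (at t)" if t: "t \<in> ?K" for t
  proof -
    have "((\<lambda>u. integral {-\<epsilon>/2..u} f) has_vector_derivative f t) (at t within {-\<epsilon>/2..\<epsilon>/2})"
      using t by (intro integral_has_vector_derivative continuous_on_subset[OF smooth_on_continuous[OF f] K(2)]) auto
    then have "((\<lambda>u. integral {-\<epsilon>/2..u} f) has_vector_derivative f t) (at t)"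
      using t at_within_interior[of t "{-\<epsilon>/2..\<epsilon>/2}"] by simp
    then show ?thesis
      unfolding l_def has_real_derivative_iff_has_vector_derivative
      using has_vector_derivative_diff[OF _ has_vector_derivative_const] by fastforce
  qed
  have dl': "(l has_derivative (\<lambda>v. f t * v)) (at t)" if "t \<in> ?K" for t
    using dl[OF that] by (simp add: has_field_derivative_def)
  have l: "smooth_on ?K l"
    by (rule smooth_on_by_derivative[OF K(3) dl'], assumption,
        intro smooth_on_mult smooth_on_const K smooth_on_subset[OF f K(1)])
  have fdl: "fd l t = (\<lambda>v. f t * v)" if "t \<in> ?K" for t
    by (rule fd_eq[OF dl'[OF that]])
  have "0 \<in> ?K" using assms(1) by simp
  moreover have "inj (fd l 0)"
    using f0[of 0] assms(1) by (simp add: fdl[OF calculation] inj_on_def)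
  ultimately obtain U V g where UV: "open U" "U \<subseteq> ?K" "0 \<in> U" "open V" "homeomorphism U V l g"
    and g: "\<And>y. y \<in> V \<Longrightarrow> \<exists>g'. (g has_derivative g') (at y) \<and>
       (\<forall>k. fd l (g y) (g' k) = k) \<and> (\<forall>k. g' (fd l (g y) k) = k)"
    using smooth_inverse_function[OF K(3) l] by metis
  have "l 0 = 0" by (simp add: l_def)
  then have "0 \<in> V" and g0: "g 0 = 0"
    using homeomorphism_image1[OF UV(5)] homeomorphism_apply1[OF UV(5)] UV(3) by force+
  then obtain \<delta> where \<delta>: "\<delta> > 0" "ball 0 \<delta> \<subseteq> V" using UV(4) openE by blast
  have bV: "{-\<delta><..<\<delta>} \<subseteq> V" using \<delta>(2) by (simp add: ball_eq_greaterThanLessThan)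
  have gK: "g t \<in> ?K" if "t \<in> {-\<delta><..<\<delta>}" for t
    using homeomorphism_image2[OF UV(5)] bV UV(2) that by blast
  have dg: "(g has_real_derivative inverse (f (g t))) (at t)" if t: "t \<in> {-\<delta><..<\<delta>}" for t
  proof -
    obtain g' where g': "(g has_derivative g') (at t)" "\<And>k. fd l (g t) (g' k) = k"
      using g[OF subsetD[OF bV t]] by blast
    then have "f (g t) * g' k = k" for k using fdl[OF gK[OF t]] by simp
    then have "g' = (\<lambda>k. inverse (f (g t)) * k)"
      using f0 gK[OF t] K(1) by (auto simp: fun_eq_iff field_simps)
    then show ?thesis using g'(1) by (simp add: has_field_derivative_def)
  qed
  have inv: "inverse (f t) = \<sigma> / norm (fd \<gamma> t 1)" for t
    using inverse_unique[OF \<sigma>(2)] by (simp add: f_def divide_inverse)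
  show ?thesis
  proof (rule that[of \<delta> g, OF \<delta>(1) g0])
    show "smooth_on {-\<delta><..<\<delta>} g"
    proof (rule smooth_solution_autonomous[OF _ K(3) _ _ dg])
      show "smooth_on ?K (\<lambda>x. inverse (f x))"
        using f0 K by (intro smooth_on_inverse smooth_on_subset[OF f K(1)]) auto
    qed (use gK in auto)
    show "g ` {-\<delta><..<\<delta>} \<subseteq> {-\<epsilon><..<\<epsilon>}" using gK K(1) by blast
    show "inj_on g {-\<delta><..<\<delta>}"
      using homeomorphism_apply2[OF UV(5)] bV by (intro inj_on_inverseI[of _ l]) blast
    show "(g has_real_derivative \<sigma> / norm (fd \<gamma> (g t) 1)) (at t)" if "t \<in> {-\<delta><..<\<delta>}" for t
      using dg[OF that] by (simp add: inv)
  qed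
qed

text \<open>A ruling \<open>d\<close> that is orthogonal to a base curve in \<open>S\<close> and makes a constant angle with \<open>S\<close> lies in
  the plane spanned by the two normals \<open>N\<^sub>\<beta>\<close> and \<open>\<eta>\<close> of the Darboux frame. Its component along
  \<open>\<eta>\<close> is constant, so its component along \<open>N\<^sub>\<beta>\<close> is constant up to sign, hence constant by continuity.
  Reversing the curve changes the sign of \<open>N\<^sub>\<beta>\<close> but not of \<open>\<eta>\<close>, which makes that component nonnegative.\<close>

lemma darboux_parametrization:
  fixes \<gamma> d :: "real \<Rightarrow> real^3"
  assumes "\<epsilon> > 0" and \<gamma>: "smooth_on {-\<epsilon><..<\<epsilon>} \<gamma>" and d: "smooth_on {-\<epsilon><..<\<epsilon>} d"
    and X: "local_parametrization M (\<lambda>(\<sigma>, z). \<gamma> \<sigma> + z *\<^sub>R d \<sigma>) ({-\<epsilon><..<\<epsilon>} \<times> J)"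
    and J: "open J" "is_interval J" "0 \<in> J"
    and \<eta>: "unit_normal_field S \<eta>" "\<And>x w. x \<in> S \<Longrightarrow> \<eta> x \<bullet> w = 0 \<Longrightarrow> w \<in> tangent_space S x"
    and \<gamma>S: "\<And>t. t \<in> {-\<epsilon><..<\<epsilon>} \<Longrightarrow> \<gamma> t \<in> S"
    and dn: "\<And>t. t \<in> {-\<epsilon><..<\<epsilon>} \<Longrightarrow> norm (d t) = 1" "\<And>t. t \<in> {-\<epsilon><..<\<epsilon>} \<Longrightarrow> d t \<bullet> fd \<gamma> t 1 = 0"
      "\<And>t. t \<in> {-\<epsilon><..<\<epsilon>} \<Longrightarrow> d t \<bullet> \<eta> (\<gamma> t) = sin \<phi>"
    and \<phi>: "0 < \<phi>" "\<phi> \<le> pi / 2" and p: "p = \<gamma> 0 + zp *\<^sub>R d 0" "zp \<in> J"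
  shows "\<exists>I \<beta> T B. open I \<and> is_interval I \<and> smooth_on I \<beta> \<and> darboux_frame S \<eta> I \<beta> T B \<and>
       (let X = (\<lambda>(t, z). \<beta> t + z *\<^sub>R (cos \<phi> *\<^sub>R B t + sin \<phi> *\<^sub>R \<eta> (\<beta> t)))
        in local_parametrization M X (I \<times> J) \<and> p \<in> X ` (I \<times> J))"
proof -
  let ?E = "{-\<epsilon><..<\<epsilon>}"
  have op: "open ?E" by simp
  have reg: "fd \<gamma> t 1 \<noteq> 0" if t: "t \<in> ?E" for t
  proof
    assume 0: "fd \<gamma> t 1 = 0"
    let ?X = "\<lambda>(\<sigma>, z). \<gamma> \<sigma> + z *\<^sub>R d \<sigma>"
    have mem: "(t, 0) + 0 *\<^sub>R (1, 0) \<in> ?E \<times> J" using t J(3) by simp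
    have "(t, 0) \<in> ?E \<times> J" using t J(3) by simp
    note inj = local_parametrizationD(3)[OF X this] and lin = fd_linear[OF local_parametrizationD(2)[OF X] this]
    have "((\<lambda>s. ?X ((t, 0) + s *\<^sub>R (1, 0))) has_vector_derivative fd ?X (t, 0) (1, 0)) (at 0)"
      using curve_has_derivative[OF local_parametrizationD(2)[OF X] mem] by simp
    moreover have "((\<lambda>s. \<gamma> (t + s *\<^sub>R 1)) has_vector_derivative fd \<gamma> t 1) (at 0)"
      using curve_has_derivative[OF \<gamma>, of t 0 1] t by simp
    ultimately have "fd ?X (t, 0) (1, 0) = 0"
      using 0 by (simp add: vector_derivative_unique_at)
    then have "fd ?X (t, 0) (1, 0) = fd ?X (t, 0) 0" using linear_0[OF lin] by simp
    then show False using inj by (auto dest: injD simp: zero_prod_def)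
  qed
  have cont_\<eta>: "continuous_on ?E (\<lambda>t. \<eta> (\<gamma> t))"
  proof (rule continuous_on_compose2[OF _ smooth_on_continuous[OF \<gamma>]])
    show "continuous_on S \<eta>" using \<eta>(1) by (simp add: unit_normal_field_def)
    show "\<gamma> ` ?E \<subseteq> S" using \<gamma>S by blast
  qed
  have n\<eta>: "norm (\<eta> (\<gamma> t)) = 1" "\<eta> (\<gamma> t) \<bullet> fd \<gamma> t 1 = 0" if "t \<in> ?E" for t
    using \<eta>(1) curve_in_tangent_space[OF op \<gamma> \<gamma>S that] \<gamma>S[OF that] by (auto simp: unit_normal_field_def)
  define \<tau> where "\<tau> t = sgn (fd \<gamma> t 1)" for t
  have \<tau>: "smooth_on ?E \<tau>" unfolding \<tau>_def by (intro smooth_on_sgn op smooth_on_fd \<gamma> reg)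
  have n\<tau>: "norm (\<tau> t) = 1" "\<eta> (\<gamma> t) \<bullet> \<tau> t = 0" "d t \<bullet> \<tau> t = 0" if "t \<in> ?E" for t
    using reg[OF that] n\<eta>[OF that] dn(2)[OF that] by (simp_all add: \<tau>_def norm_sgn sgn_div_norm)
  define c where "c t = d t \<bullet> cross3 (\<eta> (\<gamma> t)) (\<tau> t)" for t
  have d_eq: "d t = sin \<phi> *\<^sub>R \<eta> (\<gamma> t) + c t *\<^sub>R cross3 (\<eta> (\<gamma> t)) (\<tau> t)" if "t \<in> ?E" for t
    using frame_expansion(1)[OF n\<eta>(1)[OF that] n\<tau>(1,2)[OF that], of "d t"] n\<tau>(3)[OF that] dn(3)[OF that]
    by (simp add: c_def)
  have c2: "(c t)\<^sup>2 = (cos \<phi>)\<^sup>2" if "t \<in> ?E" for t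
  proof -
    let ?b = "cross3 (\<eta> (\<gamma> t)) (\<tau> t)"
    have "?b \<bullet> ?b = 1" "\<eta> (\<gamma> t) \<bullet> \<eta> (\<gamma> t) = 1" "d t \<bullet> d t = 1"
      using frame_expansion(2)[OF n\<eta>(1)[OF that] n\<tau>(1,2)[OF that]] n\<eta>(1)[OF that] dn(1)[OF that]
      by (simp_all add: norm_eq_1)
    moreover have "d t \<bullet> d t = sin \<phi> * sin \<phi> * (\<eta> (\<gamma> t) \<bullet> \<eta> (\<gamma> t)) + c t * c t * (?b \<bullet> ?b)"
      by (subst (1 2) d_eq[OF that])
         (simp add: inner_add_left inner_add_right dot_cross_self)
    ultimately have "1 = (sin \<phi>)\<^sup>2 + (c t)\<^sup>2" by (simp add: power2_eq_square)
    then show ?thesis using sin_cos_squared_add[of \<phi>] by linarith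
  qed
  have "continuous_on ?E c"
    unfolding c_def
    by (intro continuous_on_inner continuous_on_cross cont_\<eta> smooth_on_continuous[OF d] smooth_on_continuous[OF \<tau>])
  moreover have "c ` ?E \<subseteq> {cos \<phi>, - cos \<phi>}"
    using c2 by (intro image_subsetI) (simp add: power2_eq_iff)
  ultimately have "c constant_on ?E"
    by (intro continuous_finite_range_constant) (auto intro: finite_subset)
  then obtain c0 where c0: "\<And>t. t \<in> ?E \<Longrightarrow> c t = c0" by (auto simp: constant_on_def)
  define \<sigma> :: real where "\<sigma> = (if c0 \<ge> 0 then 1 else -1)"
  have \<sigma>: "\<sigma>\<^sup>2 = 1" "\<sigma> * \<sigma> = 1" "\<bar>\<sigma>\<bar> = 1" by (auto simp: \<sigma>_def)
  have "cos \<phi> \<ge> 0" using \<phi> by (intro cos_ge_zero) auto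
  then have cos_eq: "cos \<phi> = \<sigma> * c0"
    using c2[of 0] c0[of 0] assms(1) by (auto simp: \<sigma>_def power2_eq_iff)
  obtain \<delta> g where g: "\<delta> > 0" "g 0 = 0" "smooth_on {-\<delta><..<\<delta>} g" "g ` {-\<delta><..<\<delta>} \<subseteq> ?E" "inj_on g {-\<delta><..<\<delta>}"
    and dg: "\<And>t. t \<in> {-\<delta><..<\<delta>} \<Longrightarrow> (g has_real_derivative \<sigma> / norm (fd \<gamma> (g t) 1)) (at t)"
    using arclength_parameter[OF assms(1) \<gamma> reg \<sigma>(1)] by metis
  let ?I = "{-\<delta><..<\<delta>}"
  have gE: "g t \<in> ?E" if "t \<in> ?I" for t using g(4) that by blast
  define \<beta> where "\<beta> t = \<gamma> (g t)" for t
  define T where "T t = \<sigma> *\<^sub>R \<tau> (g t)" for t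
  define B where "B t = cross3 (\<eta> (\<beta> t)) (T t)" for t
  have \<beta>: "smooth_on ?I \<beta>" unfolding \<beta>_def
    by (rule smooth_on_compose[OF \<gamma> g(3) _ op g(4)]) simp
  have frame: "darboux_frame S \<eta> ?I \<beta> T B"
    unfolding darboux_frame_def
  proof (intro ballI conjI)
    fix t assume t: "t \<in> ?I"
    note E = gE[OF t]
    show "\<beta> t \<in> S" using \<gamma>S[OF E] by (simp add: \<beta>_def)
    have "(\<beta> has_vector_derivative (\<sigma> / norm (fd \<gamma> (g t) 1)) *\<^sub>R fd \<gamma> (g t) 1) (at t)"
      unfolding \<beta>_def
      using vector_diff_chain_at[of g _ t \<gamma>, OF _ smooth_on_real_has_derivative[OF \<gamma> E]] dg[OF t]
      by (simp add: has_real_derivative_iff_has_vector_derivative comp_def)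
    then show "(\<beta> has_vector_derivative T t) (at t)"
      by (simp add: T_def \<tau>_def sgn_div_norm divide_inverse)
    show T1: "norm (T t) = 1" using n\<tau>(1)[OF E] \<sigma> by (simp add: T_def)
    have T2: "\<eta> (\<beta> t) \<bullet> T t = 0" using n\<tau>(2)[OF E] by (simp add: T_def \<beta>_def)
    have "norm (\<eta> (\<beta> t)) = 1" using n\<eta>(1)[OF E] by (simp add: \<beta>_def)
    then show "norm (B t) = 1"
      unfolding B_def by (rule frame_expansion(2)[OF _ T1 T2])
    show "B t \<in> tangent_space S (\<beta> t)"
      using \<eta>(2)[OF \<open>\<beta> t \<in> S\<close>] by (simp add: B_def dot_cross_self)
    show "B t \<bullet> T t = 0" by (simp add: B_def dot_cross_self)
    show "\<eta> (\<beta> t) = cross3 (T t) (B t)"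
      unfolding B_def Lagrange using T1 T2 by (simp add: norm_eq_1 inner_commute)
  qed
  define Z where "Z = (\<lambda>(t, z). \<beta> t + z *\<^sub>R (cos \<phi> *\<^sub>R B t + sin \<phi> *\<^sub>R \<eta> (\<beta> t)))"
  have Z_eq: "Z r = (\<lambda>(\<sigma>, z). \<gamma> \<sigma> + z *\<^sub>R d \<sigma>) (g (fst r), snd r)" if "r \<in> ?I \<times> J" for r
  proof -
    have "g (fst r) \<in> ?E" using gE that by auto
    then have "d (g (fst r)) = cos \<phi> *\<^sub>R B (fst r) + sin \<phi> *\<^sub>R \<eta> (\<beta> (fst r))"
      using d_eq[of "g (fst r)"] c0[of "g (fst r)"] \<sigma>(2)
      by (simp add: B_def T_def cos_eq \<beta>_def cross_mult_right mult.commute mult.left_commute)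
    then show ?thesis by (simp add: Z_def case_prod_unfold \<beta>_def)
  qed
  have opI: "open (?I \<times> J)" using J(1) by (simp add: open_Times)
  have "local_parametrization M Z (?I \<times> J)"
  proof (rule local_parametrization_reparam[OF X opI, where \<kappa> = "\<lambda>r. (g (fst r), snd r)"])
    have "smooth_on (?I \<times> J) (\<lambda>r. (g (fst r), snd r))"
    proof (rule smooth_on_Pair[OF opI])
      show "smooth_on (?I \<times> J) (\<lambda>r. g (fst r))"
        by (rule smooth_on_compose[OF g(3) smooth_on_linear[OF opI bounded_linear_fst] opI]) auto
    qed (rule smooth_on_linear[OF opI bounded_linear_snd])
    then have "smooth_on (?I \<times> J) (\<lambda>r. (\<lambda>(\<sigma>, z). \<gamma> \<sigma> + z *\<^sub>R d \<sigma>) (g (fst r), snd r))"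
      using gE
      by (intro smooth_on_compose[OF local_parametrizationD(2)[OF X] _ opI local_parametrizationD(1)[OF X]]) auto
    then show "smooth_on (?I \<times> J) Z"
      by (rule smooth_on_cong[OF _ opI]) (rule Z_eq[symmetric])
    show "inj_on (\<lambda>r. (g (fst r), snd r)) (?I \<times> J)"
      using g(5) by (auto simp: inj_on_def)
    fix r assume r: "r \<in> ?I \<times> J"
    then have t: "fst r \<in> ?I" "snd r \<in> J" by auto
    show "(g (fst r), snd r) \<in> ?E \<times> J \<and> Z r = (\<lambda>(\<sigma>, z). \<gamma> \<sigma> + z *\<^sub>R d \<sigma>) (g (fst r), snd r)"
      using Z_eq[OF r] gE[OF t(1)] t(2) by simp
    let ?c = "\<sigma> / norm (fd \<gamma> (g (fst r)) 1)"
    have "((\<lambda>r. g (fst r)) has_derivative (\<lambda>v. ?c * fst v)) (at r)"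
      using has_derivative_compose[OF has_derivative_fst[OF has_derivative_ident] dg[OF t(1), unfolded has_field_derivative_def]] .
    then have "((\<lambda>r. (g (fst r), snd r)) has_derivative (\<lambda>v. (?c * fst v, snd v))) (at r)"
      by (intro has_derivative_Pair has_derivative_snd[OF has_derivative_ident])
    moreover have "?c \<noteq> 0" using reg[OF gE[OF t(1)]] \<sigma> by auto
    then have "inj (\<lambda>v. (?c * fst v, snd v))"
      by (intro injI) (simp add: prod_eq_iff)
    ultimately show "\<exists>\<kappa>'. ((\<lambda>r. (g (fst r), snd r)) has_derivative \<kappa>') (at r) \<and> inj \<kappa>'" by blast
  qed
  moreover have "p \<in> Z ` (?I \<times> J)"
  proof (rule image_eqI)
    show "(0, zp) \<in> ?I \<times> J" using p(2) g(1) by simp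
    then show "p = Z (0, zp)" using Z_eq p(1) g(2) by simp
  qed
  ultimately show ?thesis
    using \<beta> frame unfolding Let_def Z_def[symmetric]
    by (intro exI[of _ ?I] exI[of _ \<beta>] exI[of _ T] exI[of _ B] conjI)
       (simp_all add: Z_def is_interval_def)
qed

section \<open>Totally umbilical surfaces orthogonal to the axis\<close>

definition darboux_ruled_at :: "(real^3) set \<Rightarrow> (real^3 \<Rightarrow> real^3) \<Rightarrow> real^3 \<Rightarrow> bool" where
  "darboux_ruled_at M Y p \<longleftrightarrow>
    (\<exists>\<phi> S \<eta> I J \<beta> T B.
       0 < \<phi> \<and> \<phi> \<le> pi / 2 \<and>
       totally_umbilical S \<and> unit_normal_field S \<eta> \<and> (\<forall>q\<in>S. \<exists>k. Y q = k *\<^sub>R \<eta> q) \<and>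
       open I \<and> is_interval I \<and> open J \<and> is_interval J \<and> 0 \<in> J \<and>
       smooth_on I \<beta> \<and> darboux_frame S \<eta> I \<beta> T B \<and>
       (let X = (\<lambda>(t, z). \<beta> t + z *\<^sub>R (cos \<phi> *\<^sub>R B t + sin \<phi> *\<^sub>R \<eta> (\<beta> t)))
        in local_parametrization M X (I \<times> J) \<and> p \<in> X ` (I \<times> J)))"

text \<open>The surface \<open>S\<close> with normal \<open>\<eta>\<close> is an admissible support of base curves for the axis \<open>Y\<close>. All
  vectors orthogonal to \<open>\<eta>\<close> have to be tangent to \<open>S\<close> for the Darboux frame to exist.\<close>

definition umbilical_support ::
  "(real^3) set \<Rightarrow> (real^3 \<Rightarrow> real^3) \<Rightarrow> (real^3 \<Rightarrow> real^3) \<Rightarrow> bool" where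
  "umbilical_support S \<eta> Y \<longleftrightarrow> totally_umbilical S \<and> unit_normal_field S \<eta> \<and>
     (\<forall>q\<in>S. \<exists>k. Y q = k *\<^sub>R \<eta> q) \<and> (\<forall>x\<in>S. \<forall>w. \<eta> x \<bullet> w = 0 \<longrightarrow> w \<in> tangent_space S x)"

lemma derivative_zero_if_locally_constant:
  assumes "e > 0" "\<And>t. t \<in> {-e<..<e} \<Longrightarrow> f t = c" "(f has_real_derivative k) (at (0::real))"
  shows "k = 0"
proof -
  have "((\<lambda>t. c) has_real_derivative k) (at 0)"
    using has_field_derivative_transform_within_open[OF assms(3), of "{-e<..<e}" "\<lambda>t. c"] assms(1,2) by simp
  then show ?thesis using DERIV_unique DERIV_const by blast
qed

lemma umbilical_support_plane:
  assumes "v \<noteq> 0" "\<And>q. Y q = v"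
  shows "umbilical_support {x. v \<bullet> x = b} (\<lambda>x. sgn v) Y"
  unfolding umbilical_support_def unit_normal_field_def
proof (intro conjI ballI allI impI)
  show "totally_umbilical {x. v \<bullet> x = b}"
    using assms(1) by (auto simp: totally_umbilical_def is_plane_def)
  show "\<exists>k. Y q = k *\<^sub>R sgn v" for q
    using assms by (intro exI[of _ "norm v"]) (simp add: sgn_div_norm)
  show "norm (sgn v) = 1" using assms(1) by (simp add: norm_sgn)
  show "sgn v \<bullet> w = 0" if w: "w \<in> tangent_space {x. v \<bullet> x = b} x" for x w
  proof -
    obtain \<gamma> e where e: "e > 0" "\<gamma> ` {-e<..<e} \<subseteq> {x. v \<bullet> x = b}" "(\<gamma> has_vector_derivative w) (at 0)"
      using w by (auto simp: tangent_space_def)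
    have "((\<lambda>t. v \<bullet> \<gamma> t) has_real_derivative v \<bullet> w) (at 0)"
      using bounded_linear.has_vector_derivative[OF bounded_linear_inner_right e(3)]
      by (simp add: has_real_derivative_iff_has_vector_derivative)
    then have "v \<bullet> w = 0"
      by (rule derivative_zero_if_locally_constant[OF e(1), where c = b, rotated]) (use e(2) in blast)
    then show ?thesis by (simp add: sgn_div_norm)
  qed
  show "w \<in> tangent_space {x. v \<bullet> x = b} x" if "x \<in> {x. v \<bullet> x = b}" "sgn v \<bullet> w = 0" for x w
  proof -
    have "v \<bullet> w = 0" using that(2) assms(1) by (simp add: sgn_div_norm)
    moreover have "smooth_on {-1<..<1} (\<lambda>t::real. x + t *\<^sub>R w)"
      by (intro smooth_on_add smooth_on_const smooth_on_linear bounded_linear_scaleR_left) auto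
    moreover have "((\<lambda>t. x + t *\<^sub>R w) has_vector_derivative w) (at 0)"
      by (auto intro!: derivative_eq_intros)
    ultimately show ?thesis
      using that(1) unfolding tangent_space_def
      by (intro CollectI exI[of _ "\<lambda>t. x + t *\<^sub>R w"] exI[of _ 1] conjI image_subsetI)
         (simp_all add: inner_add_right)
  qed
qed auto

text \<open>A vector \<open>w\<close> orthogonal to the radius at \<open>x\<close> is the velocity of the radial projection of the line
  \<open>x + t *\<^sub>R w\<close> to the sphere.\<close>

lemma umbilical_support_sphere:
  assumes "r > 0" "\<And>q. Y q = \<mu> *\<^sub>R (q - p0)"
  shows "umbilical_support (sphere p0 r) (\<lambda>x. (1 / r) *\<^sub>R (x - p0)) Y"
  unfolding umbilical_support_def unit_normal_field_def
proof (intro conjI ballI allI impI)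
  show "totally_umbilical (sphere p0 r)"
    using assms(1) by (auto simp: totally_umbilical_def is_sphere_def)
  show "\<exists>k. Y q = k *\<^sub>R (1 / r) *\<^sub>R (q - p0)" for q
    using assms by (intro exI[of _ "\<mu> * r"]) simp
  show "continuous_on (sphere p0 r) (\<lambda>x. (1 / r) *\<^sub>R (x - p0))"
    by (intro continuous_intros)
  show "norm ((1 / r) *\<^sub>R (x - p0)) = 1" if "x \<in> sphere p0 r" for x
    using that assms(1) by (simp add: dist_norm norm_minus_commute)
  show "((1 / r) *\<^sub>R (x - p0)) \<bullet> w = 0" if w: "w \<in> tangent_space (sphere p0 r) x" for x w
  proof -
    obtain \<gamma> e where e: "e > 0" "\<gamma> ` {-e<..<e} \<subseteq> sphere p0 r" "(\<gamma> has_vector_derivative w) (at 0)" "\<gamma> 0 = x"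
      using w by (auto simp: tangent_space_def)
    have "((\<lambda>t. \<gamma> t - p0) has_derivative (\<lambda>h. h *\<^sub>R w)) (at 0)"
      using has_derivative_diff[OF e(3)[unfolded has_vector_derivative_def] has_derivative_const] by simp
    note has_derivative_inner[OF this this]
    moreover have "(\<lambda>h. (\<gamma> 0 - p0) \<bullet> (h *\<^sub>R w) + (h *\<^sub>R w) \<bullet> (\<gamma> 0 - p0)) = (*) (2 * ((x - p0) \<bullet> w))"
      by (simp add: fun_eq_iff e(4) inner_commute)
    ultimately have "((\<lambda>t. (\<gamma> t - p0) \<bullet> (\<gamma> t - p0)) has_real_derivative 2 * ((x - p0) \<bullet> w)) (at 0)"
      by (simp only: has_field_derivative_def)
    then have "2 * ((x - p0) \<bullet> w) = 0"
    proof (rule derivative_zero_if_locally_constant[OF e(1), rotated])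
      fix t assume "t \<in> {-e<..<e}"
      then have "\<gamma> t \<in> sphere p0 r" using e(2) by blast
      then have "norm (\<gamma> t - p0) = r" by (simp add: dist_norm norm_minus_commute)
      then show "(\<gamma> t - p0) \<bullet> (\<gamma> t - p0) = r\<^sup>2" by (simp add: power2_norm_eq_inner[symmetric])
    qed
    then show ?thesis by simp
  qed
  show "w \<in> tangent_space (sphere p0 r) x"
    if x: "x \<in> sphere p0 r" and w: "((1 / r) *\<^sub>R (x - p0)) \<bullet> w = 0" for x w
  proof -
    let ?q = "\<lambda>t::real. r\<^sup>2 + t * t * (w \<bullet> w)"
    let ?\<gamma> = "\<lambda>t::real. p0 + (r * inverse (sqrt (?q t))) *\<^sub>R (x - p0 + t *\<^sub>R w)"
    have w: "(x - p0) \<bullet> w = 0" using w assms(1) by simp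
    have xr: "(x - p0) \<bullet> (x - p0) = r\<^sup>2"
      using x by (simp add: power2_norm_eq_inner[symmetric] dist_norm norm_minus_commute)
    have q: "?q t > 0" for t
      using assms(1) by (intro add_pos_nonneg) auto
    have op: "open {-1<..<1::real}" by simp
    have idt: "smooth_on {-1<..<1} (\<lambda>t::real. t)" by (rule smooth_on_linear[OF op bounded_linear_ident])
    have smq: "smooth_on {-1<..<1} ?q"
      by (intro smooth_on_add smooth_on_mult smooth_on_const idt op)
    have "smooth_on {-1<..<1} ?\<gamma>"
      using q less_imp_neq[OF q]
      by (intro smooth_on_add smooth_on_scaleR smooth_on_mult smooth_on_inverse smooth_on_sqrt smq
          smooth_on_const idt op) (simp_all add: real_sqrt_eq_zero_cancel_iff less_imp_neq[symmetric])
    moreover have "?\<gamma> t \<in> sphere p0 r" for t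
    proof -
      have "(norm (x - p0 + t *\<^sub>R w))\<^sup>2 = ?q t"
        using w xr by (simp add: power2_norm_eq_inner inner_add_left inner_add_right inner_commute)
      then have "norm (x - p0 + t *\<^sub>R w) = sqrt (?q t)"
        by (metis norm_ge_zero real_sqrt_unique)
      then show ?thesis using assms(1) q[of t] by (simp add: dist_norm)
    qed
    moreover have "?\<gamma> 0 = x" using assms(1) by simp
    moreover have "(?\<gamma> has_vector_derivative w) (at 0)"
    proof -
      have "((\<lambda>t. r * inverse (sqrt (?q t))) has_real_derivative 0) (at 0)"
        using assms(1) by (auto intro!: derivative_eq_intros)
      moreover have "((\<lambda>t. x - p0 + t *\<^sub>R w) has_vector_derivative w) (at 0)"
        by (auto intro!: derivative_eq_intros)
      ultimately have "(?\<gamma> has_vector_derivative (0 + ((r * inverse (sqrt (?q 0))) *\<^sub>R w + 0 *\<^sub>R (x - p0 + 0 *\<^sub>R w)))) (at 0)"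
        by (intro has_vector_derivative_add has_vector_derivative_const has_vector_derivative_scaleR)
      then show ?thesis using assms(1) by simp
    qed
    ultimately show ?thesis
      unfolding tangent_space_def
      by (intro CollectI exI[of _ ?\<gamma>] exI[of _ 1]) auto
  qed
qed

text \<open>The base curve is cut out of the ruled piece by a surface \<open>S\<close>, at signed distance \<open>z1\<close> along the
  rulings from the curve \<open>s = 0\<close>. At a point where \<open>Y\<close> is normal to \<open>M\<close>, \<open>z1 = 0\<close> would not do, as the
  rulings would be tangent to \<open>S\<close>; hence the freedom to choose \<open>z1\<close>.\<close>

lemma darboux_ruled_if_ruling_field:
  assumes X: "local_parametrization M X D" and "u0 \<in> D"
    and e: "smooth_on D e" "\<And>u. u \<in> D \<Longrightarrow> norm (e u) = 1"
    and s: "smooth_on D s" "s u0 = 0" "\<And>u a. u \<in> D \<Longrightarrow> fd s u a = fd X u a \<bullet> e u"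
    and ruling: "\<And>u. u \<in> D \<Longrightarrow> \<exists>W. fd X u W = e u \<and> fd e u W = 0"
    and S: "\<And>\<epsilon>. \<epsilon> > 0 \<Longrightarrow> \<exists>z1 S \<eta> \<phi>. \<bar>z1\<bar> < \<epsilon> \<and> 0 < \<phi> \<and> \<phi> \<le> pi / 2 \<and> umbilical_support S \<eta> Y \<and>
      (\<forall>u\<in>D. X u - s u *\<^sub>R e u + z1 *\<^sub>R e u \<in> S \<and> e u \<bullet> \<eta> (X u - s u *\<^sub>R e u + z1 *\<^sub>R e u) = sin \<phi>)"
  shows "darboux_ruled_at M Y (X u0)"
proof -
  note D = local_parametrizationD[OF X]
  obtain \<epsilon> w where \<epsilon>: "\<epsilon> > 0" and wD': "\<forall>\<sigma>\<in>{-\<epsilon><..<\<epsilon>}. u0 + \<sigma> *\<^sub>R w \<in> D"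
    and X0: "local_parametrization M
       (\<lambda>(\<sigma>, z). X (u0 + \<sigma> *\<^sub>R w) - s (u0 + \<sigma> *\<^sub>R w) *\<^sub>R e (u0 + \<sigma> *\<^sub>R w) + z *\<^sub>R e (u0 + \<sigma> *\<^sub>R w))
       ({-\<epsilon><..<\<epsilon>} \<times> {-\<epsilon><..<\<epsilon>})"
    by (rule ruled_parametrization[OF X \<open>u0 \<in> D\<close> e s ruling])
  have wD: "u0 + \<sigma> *\<^sub>R w \<in> D" if "\<sigma> \<in> {-\<epsilon><..<\<epsilon>}" for \<sigma>
    using wD' that by blast
  obtain z1 S \<eta> \<phi> where z1: "\<bar>z1\<bar> < \<epsilon>" and \<phi>: "0 < \<phi>" "\<phi> \<le> pi / 2" and sup: "umbilical_support S \<eta> Y"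
    and kS: "\<And>u. u \<in> D \<Longrightarrow> X u - s u *\<^sub>R e u + z1 *\<^sub>R e u \<in> S"
      "\<And>u. u \<in> D \<Longrightarrow> e u \<bullet> \<eta> (X u - s u *\<^sub>R e u + z1 *\<^sub>R e u) = sin \<phi>"
    using S[OF \<epsilon>] by blast
  let ?E = "{-\<epsilon><..<\<epsilon>}" and ?J = "{-\<epsilon>-z1<..<\<epsilon>-z1}"
  define k where "k u = X u - s u *\<^sub>R e u + z1 *\<^sub>R e u" for u
  define \<gamma> where "\<gamma> \<sigma> = k (u0 + \<sigma> *\<^sub>R w)" for \<sigma>
  define d where "d \<sigma> = e (u0 + \<sigma> *\<^sub>R w)" for \<sigma>
  have ks: "smooth_on D k" unfolding k_def
    by (intro smooth_on_add smooth_on_diff smooth_on_scaleR smooth_on_const D(1,2) e(1) s(1))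
  have \<gamma>: "smooth_on ?E \<gamma>" unfolding \<gamma>_def by (rule smooth_on_curve[OF ks D(1) _ wD]) auto
  have d: "smooth_on ?E d" unfolding d_def by (rule smooth_on_curve[OF e(1) D(1) _ wD]) auto
  have ke: "e u \<bullet> fd k u a = 0" if u: "u \<in> D" for u a
  proof -
    have ee: "e u \<bullet> e u = 1" using e(2)[OF u] by (simp add: norm_eq_1)
    have de: "e u \<bullet> fd e u a = 0"
      by (rule unit_fd_orthogonal[OF D(1) e u])
    have "fd k u a = fd X u a - (s u *\<^sub>R fd e u a + fd s u a *\<^sub>R e u) + z1 *\<^sub>R fd e u a"
    proof -
      have se: "smooth_on D (\<lambda>u. s u *\<^sub>R e u)" "smooth_on D (\<lambda>u. z1 *\<^sub>R e u)" "smooth_on D (\<lambda>u. X u - s u *\<^sub>R e u)"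
        by (intro smooth_on_diff smooth_on_scaleR smooth_on_const D(1,2) e(1) s(1))+
      show ?thesis
        unfolding k_def
        by (simp add: fd_add[OF se(3,2) u] fd_diff[OF D(2) se(1) u] fd_scaleR[OF s(1) e(1) u]
            fd_scaleR[OF smooth_on_const[OF D(1)] e(1) u])
    qed
    then show ?thesis
      using s(3)[OF u] ee de by (simp add: inner_diff_right inner_add_right inner_commute)
  qed
  have \<gamma>': "fd \<gamma> t 1 = fd k (u0 + t *\<^sub>R w) w" if t: "t \<in> ?E" for t
  proof (rule vector_derivative_unique_at)
    show "(\<gamma> has_vector_derivative fd \<gamma> t 1) (at t)" by (rule smooth_on_real_has_derivative[OF \<gamma> t])
    show "(\<gamma> has_vector_derivative fd k (u0 + t *\<^sub>R w) w) (at t)"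
      using curve_has_derivative[OF ks wD[OF t]] by (simp add: \<gamma>_def[abs_def])
  qed
  have X1: "local_parametrization M (\<lambda>(\<sigma>, z). \<gamma> \<sigma> + z *\<^sub>R d \<sigma>) (?E \<times> ?J)"
  proof (rule local_parametrization_reparam[OF X0, where \<kappa> = "\<lambda>r. r + (0, z1)"])
    show op: "open (?E \<times> ?J)" by (simp add: open_Times)
    have sm: "smooth_on (?E \<times> ?J) (\<lambda>r. f (fst r))" if "smooth_on ?E f" for f :: "real \<Rightarrow> real^3"
      by (rule smooth_on_compose[OF that smooth_on_linear[OF op bounded_linear_fst] op]) auto
    have "smooth_on (?E \<times> ?J) (\<lambda>r. \<gamma> (fst r) + snd r *\<^sub>R d (fst r))"
      by (intro smooth_on_add smooth_on_scaleR sm \<gamma> d op smooth_on_linear[OF op bounded_linear_snd])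
    then show "smooth_on (?E \<times> ?J) (\<lambda>(\<sigma>, z). \<gamma> \<sigma> + z *\<^sub>R d \<sigma>)" by (simp add: case_prod_unfold)
    show "\<exists>\<kappa>'. ((\<lambda>r. r + (0, z1)) has_derivative \<kappa>') (at r) \<and> inj \<kappa>'" for r :: "real \<times> real"
      by (rule exI[of _ "\<lambda>v. v"]) (auto intro!: derivative_eq_intros simp: inj_on_def)
  qed (auto simp: \<gamma>_def d_def k_def algebra_simps inj_on_def)
  define p where "p = X u0"
  have "p = \<gamma> 0 + (- z1) *\<^sub>R d 0"
    by (simp add: p_def \<gamma>_def d_def k_def s(2))
  moreover have "- z1 \<in> ?J" "0 \<in> ?J" using z1 \<epsilon> by auto
  moreover have J: "is_interval ?J" "open ?J" by (auto simp: is_interval_def)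
  moreover have "unit_normal_field S \<eta>" "\<And>x w. x \<in> S \<Longrightarrow> \<eta> x \<bullet> w = 0 \<Longrightarrow> w \<in> tangent_space S x"
    using sup by (auto simp: umbilical_support_def)
  moreover have "\<gamma> t \<in> S" "norm (d t) = 1" "d t \<bullet> fd \<gamma> t 1 = 0" "d t \<bullet> \<eta> (\<gamma> t) = sin \<phi>" if "t \<in> ?E" for t
    using kS[OF wD[OF that]] e(2)[OF wD[OF that]] ke[OF wD[OF that]]
    by (simp_all only: \<gamma>'[OF that] \<gamma>_def d_def k_def)
  ultimately have "\<exists>I \<beta> T B. open I \<and> is_interval I \<and> smooth_on I \<beta> \<and> darboux_frame S \<eta> I \<beta> T B \<and>
       (let X = (\<lambda>(t, z). \<beta> t + z *\<^sub>R (cos \<phi> *\<^sub>R B t + sin \<phi> *\<^sub>R \<eta> (\<beta> t)))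
        in local_parametrization M X (I \<times> ?J) \<and> p \<in> X ` (I \<times> ?J))"
    by (intro darboux_parametrization[OF \<epsilon> \<gamma> d X1 J(2,1)] \<phi>)
  then show ?thesis
    using sup \<phi> \<open>0 \<in> ?J\<close> J
    unfolding darboux_ruled_at_def umbilical_support_def p_def by blast
qed

section \<open>Charts of a concircular surface\<close>

locale normal_chart =
  fixes M :: "(real^3) set" and X :: "real \<times> real \<Rightarrow> real^3" and D and n :: "real \<times> real \<Rightarrow> real^3"
  assumes chart: "local_parametrization M X D"
    and n: "smooth_on D n" "\<And>u. u \<in> D \<Longrightarrow> norm (n u) = 1"
    and normal: "\<And>u a. u \<in> D \<Longrightarrow> n u \<bullet> fd X u a = 0"
begin

lemmas D = local_parametrizationD[OF chart]

lemma nn: "u \<in> D \<Longrightarrow> n u \<bullet> n u = 1"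
  using n(2) by (simp add: norm_eq_1)

lemma restrict: "open E \<Longrightarrow> E \<subseteq> D \<Longrightarrow> normal_chart M X E n"
  using local_parametrization_subset[OF chart] smooth_on_subset[OF n(1)] n(2) normal
  by unfold_locales blast+

lemmas unit_field_fd = unit_fd_orthogonal[OF D(1)]
lemmas orthogonal_fields_fd = constant_inner_fd[OF D(1)]

text \<open>The second fundamental form is symmetric because second derivatives commute.\<close>

lemma shape_symmetric:
  assumes "u \<in> D"
  shows "fd n u a \<bullet> fd X u b = fd n u b \<bullet> fd X u a"
proof -
  have *: "n u \<bullet> fd (\<lambda>x. fd X x v) u w = - (fd n u w \<bullet> fd X u v)" for v w
    by (rule orthogonal_fields_fd[OF n(1) smooth_on_fd[OF D(2)] normal assms])
  show ?thesis
    using *[of b a] *[of a b] fd_commute[OF D(1,2) assms, of b a] by simp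
qed

lemma tangent_vector:
  assumes "u \<in> D" "n u \<bullet> x = 0"
  shows "\<exists>a. fd X u a = x"
proof (rule tangent_plane_surjective[OF fd_linear[OF D(2) assms(1)] D(3)[OF assms(1)] _ _ assms(2)])
  show "n u \<noteq> 0" using nn[OF assms(1)] by auto
qed (rule normal[OF assms(1)])

text \<open>By symmetry, a tangent vector orthogonal to the whole image of \<open>dn\<close> is sent to \<open>0\<close> by \<open>dn\<close>.\<close>

lemma shape_kernel:
  assumes "u \<in> D" "\<And>b. fd n u b \<bullet> fd X u V = 0"
  shows "fd n u V = 0"
proof -
  have "n u \<bullet> fd n u V = 0" by (rule unit_field_fd[OF n assms(1)])
  then obtain a where "fd X u a = fd n u V" using tangent_vector[OF assms(1)] by blast
  then have "fd n u V \<bullet> fd n u V = 0"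
    using shape_symmetric[OF assms(1), of V a] assms(2)[of a] by simp
  then show ?thesis by simp
qed

end

text \<open>The case of an axis with \<open>\<mu> \<noteq> 0\<close>, normalized to \<open>Y q = q - p0\<close>. The vector \<open>y u\<close> is the tangential
  part of \<open>Y\<close>.\<close>

locale central_chart = normal_chart +
  fixes p0 :: "real^3" and c :: real
  assumes support: "\<And>u. u \<in> D \<Longrightarrow> n u \<bullet> (X u - p0) = c"
begin

definition y where "y u = X u - p0 - c *\<^sub>R n u"

lemma smooth_y: "smooth_on D y"
  unfolding y_def by (intro smooth_on_diff smooth_on_scaleR smooth_on_const D(1,2) n(1))

lemma fd_y: "u \<in> D \<Longrightarrow> fd y u a = fd X u a - c *\<^sub>R fd n u a"
proof -
  assume u: "u \<in> D"
  have sm: "smooth_on D (\<lambda>u. X u - p0)" "smooth_on D (\<lambda>u. c *\<^sub>R n u)"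
    by (intro smooth_on_diff smooth_on_scaleR smooth_on_const D(1,2) n(1))+
  show ?thesis
    unfolding y_def
    by (simp add: fd_diff[OF sm u] fd_diff[OF D(2) smooth_on_const[OF D(1)] u]
        fd_scaleR[OF smooth_on_const[OF D(1)] n(1) u])
qed

text \<open>Differentiating the support condition: the image of \<open>dn\<close> is orthogonal to the axis, hence to its
  tangential part, which therefore is in the kernel of \<open>dn\<close>.\<close>

lemma fd_n_position: "u \<in> D \<Longrightarrow> fd n u b \<bullet> (X u - p0) = 0"
proof -
  assume u: "u \<in> D"
  have "n u \<bullet> fd (\<lambda>u. X u - p0) u b = - (fd n u b \<bullet> (X u - p0))"
    by (rule orthogonal_fields_fd[OF n(1) _ support u])
       (intro smooth_on_diff smooth_on_const D(1,2))
  then show ?thesis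
    using normal[OF u] by (simp add: fd_diff[OF D(2) smooth_on_const[OF D(1)] u])
qed

lemma fd_n_y: "u \<in> D \<Longrightarrow> fd n u b \<bullet> y u = 0"
  using fd_n_position unit_field_fd[OF n] by (simp add: y_def inner_diff_right inner_commute)

lemma n_y: "u \<in> D \<Longrightarrow> n u \<bullet> y u = 0"
  using support nn by (simp add: y_def inner_diff_right)

lemma shape_y: "u \<in> D \<Longrightarrow> fd X u V = y u \<Longrightarrow> fd n u V = 0"
  using shape_kernel fd_n_y by simp

lemma restrict_central: "open E \<Longrightarrow> E \<subseteq> D \<Longrightarrow> central_chart M X E n p0 c"
  using restrict support unfolding central_chart_def central_chart_axioms_def by blast

text \<open>Differentiate \<open>X - p0 = c n + \<sigma> e\<close>: the \<open>e\<close>-component gives \<open>d\<sigma>\<close>, and along \<open>e\<close> itself, where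
  \<open>dn = 0\<close> and \<open>d\<sigma> = 1\<close>, only \<open>\<sigma> de = 0\<close> remains.\<close>

lemma ruling_field:
  assumes e: "smooth_on D e" "\<And>u. u \<in> D \<Longrightarrow> norm (e u) = 1" "\<And>u. u \<in> D \<Longrightarrow> n u \<bullet> e u = 0"
    and en: "\<And>u b. u \<in> D \<Longrightarrow> fd n u b \<bullet> e u = 0"
    and \<sigma>: "smooth_on D \<sigma>" "\<And>u. u \<in> D \<Longrightarrow> y u = \<sigma> u *\<^sub>R e u"
    and u: "u \<in> D"
  shows "fd \<sigma> u b = fd X u b \<bullet> e u"
    and "\<sigma> u \<noteq> 0 \<Longrightarrow> fd X u W = e u \<Longrightarrow> fd e u W = 0"
proof -
  have "fd y u b = fd (\<lambda>u. \<sigma> u *\<^sub>R e u) u b" for b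
    using \<sigma>(2) by (intro fun_cong[OF fd_cong_open[OF D(1) u]])
  then have eq: "fd X u b = c *\<^sub>R fd n u b + \<sigma> u *\<^sub>R fd e u b + fd \<sigma> u b *\<^sub>R e u" for b
    by (simp add: fd_y[OF u] fd_scaleR[OF \<sigma>(1) e(1) u] algebra_simps)
  have ee: "e u \<bullet> e u = 1" using e(2)[OF u] by (simp add: norm_eq_1)
  have d\<sigma>: "fd \<sigma> u b = fd X u b \<bullet> e u" for b
    using unit_field_fd[OF e(1,2) u, of b] en[OF u, of b] ee
    by (subst eq) (simp add: inner_add_left inner_add_right inner_commute)
  show "fd \<sigma> u b = fd X u b \<bullet> e u" by (rule d\<sigma>)
  show "fd e u W = 0" if "\<sigma> u \<noteq> 0" "fd X u W = e u"
  proof -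
    have "fd n u W = 0" by (rule shape_kernel[OF u]) (simp add: that(2) en[OF u])
    then show ?thesis using eq[of W] d\<sigma>[of W] that ee by simp
  qed
qed

text \<open>The points \<open>p0 + c n + \<rho> e\<close> with a fixed \<open>\<rho> > 0\<close> lie on a sphere about \<open>p0\<close>, which the rulings
  meet at an angle with sine \<open>\<rho> / r\<close>. One takes \<open>\<rho> = \<sigma> u0\<close>, so that the base curve passes through
  \<open>X u0\<close>, unless this is \<open>0\<close>.\<close>

lemma darboux_ruled_at_if_field:
  assumes "u0 \<in> D" and e: "smooth_on D e" "\<And>u. u \<in> D \<Longrightarrow> norm (e u) = 1" "\<And>u. u \<in> D \<Longrightarrow> n u \<bullet> e u = 0"
    and en: "\<And>u b. u \<in> D \<Longrightarrow> fd n u b \<bullet> e u = 0"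
    and \<sigma>: "smooth_on D \<sigma>" "\<And>u. u \<in> D \<Longrightarrow> y u = \<sigma> u *\<^sub>R e u" "\<sigma> u0 \<ge> 0"
    and ruling: "\<And>u W. u \<in> D \<Longrightarrow> fd X u W = e u \<Longrightarrow> fd e u W = 0"
    and Y: "\<And>q. Y q = \<mu> *\<^sub>R (q - p0)"
  shows "darboux_ruled_at M Y (X u0)"
proof -
  define s where "s u = \<sigma> u - \<sigma> u0" for u
  have s: "smooth_on D s" unfolding s_def by (intro smooth_on_diff smooth_on_const \<sigma>(1) D(1))
  show ?thesis
  proof (rule darboux_ruled_if_ruling_field[OF chart assms(1) e(1,2) s])
    show "s u0 = 0" by (simp add: s_def)
    show "fd s u a = fd X u a \<bullet> e u" if "u \<in> D" for u a
      using ruling_field(1)[OF e en \<sigma>(1,2) that, of a]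
      unfolding s_def by (simp add: fd_diff[OF \<sigma>(1) smooth_on_const[OF D(1)] that])
    show "\<exists>W. fd X u W = e u \<and> fd e u W = 0" if "u \<in> D" for u
      using tangent_vector[OF that e(3)[OF that]] ruling[OF that] by blast
    fix \<epsilon> :: real assume "\<epsilon> > 0"
    define z1 where "z1 = (if \<sigma> u0 = 0 then \<epsilon> / 2 else 0)"
    define \<rho> where "\<rho> = \<sigma> u0 + z1"
    define r where "r = sqrt (c\<^sup>2 + \<rho>\<^sup>2)"
    define \<phi> where "\<phi> = arcsin (\<rho> / r)"
    have \<rho>: "\<rho> > 0" using \<sigma>(3) \<open>\<epsilon> > 0\<close> by (auto simp: \<rho>_def z1_def)
    have r: "r > 0" "r\<^sup>2 = c\<^sup>2 + \<rho>\<^sup>2" using \<rho> by (auto simp: r_def intro: add_nonneg_pos)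
    have "\<rho> \<le> r" unfolding r_def by (rule real_le_rsqrt) simp
    then have q: "0 < \<rho> / r" "\<rho> / r \<le> 1" using \<rho> r by auto
    have "sin \<phi> = \<rho> / r" using q by (simp add: \<phi>_def sin_arcsin)
    moreover have "0 < \<phi>" unfolding \<phi>_def using arcsin_less_arcsin[of 0 "\<rho> / r"] q by simp
    moreover have "\<phi> \<le> pi / 2" unfolding \<phi>_def using q by (intro arcsin_ubound) auto
    moreover have "X u - s u *\<^sub>R e u + z1 *\<^sub>R e u \<in> sphere p0 r \<and>
       e u \<bullet> ((1 / r) *\<^sub>R (X u - s u *\<^sub>R e u + z1 *\<^sub>R e u - p0)) = \<rho> / r" if u: "u \<in> D" for u
    proof -
      have eq: "X u - s u *\<^sub>R e u + z1 *\<^sub>R e u - p0 = c *\<^sub>R n u + \<rho> *\<^sub>R e u"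
        using \<sigma>(2)[OF u] by (simp add: y_def s_def \<rho>_def algebra_simps)
      have "e u \<bullet> e u = 1" using e(2)[OF u] by (simp add: norm_eq_1)
      then have "(c *\<^sub>R n u + \<rho> *\<^sub>R e u) \<bullet> (c *\<^sub>R n u + \<rho> *\<^sub>R e u) = c * c + \<rho> * \<rho>"
        "e u \<bullet> (c *\<^sub>R n u + \<rho> *\<^sub>R e u) = \<rho>"
        using e(3)[OF u] nn[OF u]
        by (simp_all add: inner_add_left inner_add_right inner_commute)
      moreover from this have "norm (c *\<^sub>R n u + \<rho> *\<^sub>R e u) = r"
        by (simp add: norm_eq_sqrt_inner r_def power2_eq_square)
      ultimately show ?thesis
        unfolding mem_sphere dist_norm[of p0] norm_minus_commute[of p0] eq by simp
    qed
    moreover have "\<bar>z1\<bar> < \<epsilon>" using \<open>\<epsilon> > 0\<close> by (simp add: z1_def)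
    ultimately show "\<exists>z1 S \<eta> \<phi>. \<bar>z1\<bar> < \<epsilon> \<and> 0 < \<phi> \<and> \<phi> \<le> pi / 2 \<and> umbilical_support S \<eta> Y \<and>
      (\<forall>u\<in>D. X u - s u *\<^sub>R e u + z1 *\<^sub>R e u \<in> S \<and> e u \<bullet> \<eta> (X u - s u *\<^sub>R e u + z1 *\<^sub>R e u) = sin \<phi>)"
      using umbilical_support_sphere[of r Y \<mu> p0, OF r(1) Y]
      by (intro exI[of _ z1] exI[of _ "sphere p0 r"] exI[of _ "\<lambda>x. (1 / r) *\<^sub>R (x - p0)"] exI[of _ \<phi>]) simp
  qed
qed

text \<open>Where the tangential part of \<open>Y\<close> is nonzero, it spans the rulings.\<close>

lemma darboux_ruled_at_regular_point:
  assumes "u0 \<in> D" "y u0 \<noteq> 0" and Y: "\<And>q. Y q = \<mu> *\<^sub>R (q - p0)"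
  shows "darboux_ruled_at M Y (X u0)"
proof -
  define E where "E = {u \<in> D. y u \<noteq> 0}"
  have "open (D \<inter> y -` (- {0}))"
    by (intro continuous_open_preimage smooth_on_continuous[OF smooth_y] D(1)) auto
  moreover have "E = D \<inter> y -` (- {0})" by (auto simp: E_def)
  ultimately have E: "open E" "E \<subseteq> D" "u0 \<in> E" using assms by (auto simp: E_def)
  interpret E: central_chart M X E n p0 c by (rule restrict_central[OF E(1,2)])
  have y0: "y u \<noteq> 0" if "u \<in> E" for u using that by (simp add: E_def)
  have en: "fd n u b \<bullet> sgn (y u) = 0" if "u \<in> E" for u b
    using fd_n_y[OF subsetD[OF E(2) that]] by (simp add: sgn_div_norm)
  have e1: "smooth_on E (\<lambda>u. sgn (y u))"
    by (rule smooth_on_sgn[OF E(1) E.smooth_y y0])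
  have e2: "norm (sgn (y u)) = 1" if "u \<in> E" for u using y0[OF that] by (simp add: norm_sgn)
  have e3: "n u \<bullet> sgn (y u) = 0" if "u \<in> E" for u
    using n_y[OF subsetD[OF E(2) that]] by (simp add: sgn_div_norm)
  have s1: "smooth_on E (\<lambda>u. norm (y u))" by (rule smooth_on_norm[OF E(1) E.smooth_y y0])
  have s2: "y u = norm (y u) *\<^sub>R sgn (y u)" for u by (cases "y u = 0") (simp_all add: sgn_div_norm)
  show ?thesis
  proof (rule E.darboux_ruled_at_if_field[OF E(3) e1 e2 e3 en s1 s2 _ _ Y])
    show "fd (\<lambda>u. sgn (y u)) u W = 0" if "u \<in> E" "fd X u W = sgn (y u)" for u W
      by (rule E.ruling_field(2)[OF e1 e2 e3 en s1 s2 that(1) _ that(2)]) (use y0[OF that(1)] in auto)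
  qed auto
qed

text \<open>Where \<open>Y\<close> is normal to the surface and the derivative of its tangential part \<open>y\<close> is nondegenerate,
  \<open>y\<close> itself provides coordinates, in which the field of rulings becomes the Euler field. The unit
  normal is then constant along the rays from the vertex, hence constant.\<close>

lemma normal_constant_near_vertex:
  assumes "u0 \<in> D" "y u0 = 0" "inj (fd y u0)"
  obtains U where "open U" "U \<subseteq> D" "connected U" "u0 \<in> U" "\<And>u. u \<in> U \<Longrightarrow> n u = n u0"
proof -
  define a where "a = fd X u0 (1,0)"
  define b where "b = fd X u0 (0,1)"
  define \<Phi> where "\<Phi> u = (y u \<bullet> a, y u \<bullet> b)" for u
  have sm: "smooth_on D (\<lambda>u. y u \<bullet> k)" for k
    by (intro smooth_on_inner smooth_on_const smooth_y D(1))
  have \<Phi>: "smooth_on D \<Phi>" unfolding \<Phi>_def by (intro smooth_on_Pair sm D(1))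
  have d\<Phi>: "fd \<Phi> u v = (fd y u v \<bullet> a, fd y u v \<bullet> b)" if "u \<in> D" for u v
    unfolding \<Phi>_def by (simp add: fd_Pair[OF sm sm that] fd_inner_const[OF smooth_y that])
  have "inj (fd \<Phi> u0)"
  proof (subst linear_injective_0[OF fd_linear[OF \<Phi> assms(1)]], intro allI impI)
    fix v assume "fd \<Phi> u0 v = 0"
    then have ab: "fd y u0 v \<bullet> a = 0" "fd y u0 v \<bullet> b = 0"
      by (simp_all add: d\<Phi>[OF assms(1)] zero_prod_def)
    have "n u0 \<bullet> fd y u0 v = 0"
      using normal[OF assms(1)] unit_field_fd[OF n assms(1)] by (simp add: fd_y[OF assms(1)] inner_diff_right)
    then obtain k where k: "fd X u0 k = fd y u0 v" using tangent_vector[OF assms(1)] by blast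
    have "fd X u0 (fst k *\<^sub>R (1,0) + snd k *\<^sub>R (0,1)) = fst k *\<^sub>R a + snd k *\<^sub>R b"
      unfolding a_def b_def
      by (simp only: linear_add[OF fd_linear[OF D(2) assms(1)]] linear_cmul[OF fd_linear[OF D(2) assms(1)]])
    then have "fd y u0 v = fst k *\<^sub>R a + snd k *\<^sub>R b" using k by simp
    then have "fd y u0 v \<bullet> fd y u0 v = 0"
      using ab by (metis (no_types, lifting) add.right_neutral inner_add_right inner_scaleR_right mult_zero_right)
    then have "fd y u0 v = fd y u0 0" by (simp add: linear_0[OF fd_linear[OF smooth_y assms(1)]])
    then show "v = 0" using assms(3) by (auto dest: injD)
  qed
  then obtain U V \<Psi> where U: "open U" "U \<subseteq> D" "u0 \<in> U" and V: "open V"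
    and hom: "homeomorphism U V \<Phi> \<Psi>"
    and \<Psi>: "\<And>x. x \<in> V \<Longrightarrow> \<exists>g'. (\<Psi> has_derivative g') (at x) \<and>
       (\<forall>k. fd \<Phi> (\<Psi> x) (g' k) = k) \<and> (\<forall>k. g' (fd \<Phi> (\<Psi> x) k) = k)"
    using smooth_inverse_function[OF D(1) \<Phi> assms(1)] by metis
  have \<Psi>U: "\<Psi> x \<in> U" "\<Phi> (\<Psi> x) = x" if "x \<in> V" for x
    using hom that homeomorphism_image2 homeomorphism_apply2 by blast+
  have "\<Phi> u0 = 0" using assms(2) by (simp add: \<Phi>_def zero_prod_def)
  then have 0: "0 \<in> V" "\<Psi> 0 = u0"
    using homeomorphism_image1[OF hom] homeomorphism_apply1[OF hom U(3)] U(3) by force+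
  then obtain \<delta> where \<delta>: "\<delta> > 0" "ball 0 \<delta> \<subseteq> V" using V openE by blast
  have euler: "((\<lambda>x. n (\<Psi> x)) has_derivative (\<lambda>v. fd n (\<Psi> x) (g' v))) (at x) \<and> fd n (\<Psi> x) (g' x) = 0"
    if x: "x \<in> V" and g': "(\<Psi> has_derivative g') (at x)" "\<And>k. g' (fd \<Phi> (\<Psi> x) k) = k" for x g'
  proof
    let ?u = "\<Psi> x"
    have u: "?u \<in> D" using \<Psi>U(1)[OF x] U(2) by blast
    show "((\<lambda>x. n (\<Psi> x)) has_derivative (\<lambda>v. fd n ?u (g' v))) (at x)"
      by (rule has_derivative_compose[OF g'(1) smooth_on_has_derivative[OF n(1) u]])
    obtain W where W: "fd X ?u W = y ?u" using tangent_vector[OF u n_y[OF u]] by blast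
    have "fd n ?u W = 0" by (rule shape_y[OF u W])
    moreover from this have "fd \<Phi> ?u W = x"
      using \<Psi>U(2)[OF x] W by (simp add: d\<Phi>[OF u] fd_y[OF u]) (simp add: \<Phi>_def)
    ultimately show "fd n ?u (g' x) = 0" using g'(2)[of W] by simp
  qed
  have const: "n (\<Psi> x) = n u0" if x: "x \<in> ball 0 \<delta>" for x
  proof -
    let ?f = "\<lambda>t::real. n (\<Psi> (t *\<^sub>R x))"
    have tV: "t *\<^sub>R x \<in> V" if "t \<in> {0..1}" for t
    proof -
      have "norm (t *\<^sub>R x) \<le> norm x" using that by (simp add: mult_left_le_one_le)
      then have "t *\<^sub>R x \<in> ball 0 \<delta>" using x unfolding mem_ball_0 by linarith
      then show ?thesis using \<delta>(2) by blast
    qed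
    have der: "(?f has_derivative (\<lambda>s. fd n (\<Psi> (t *\<^sub>R x)) (g' (s *\<^sub>R x)))) (at t within {0..1})"
      if "t \<in> {0..1}" "(\<Psi> has_derivative g') (at (t *\<^sub>R x))" "\<And>k. g' (fd \<Phi> (\<Psi> (t *\<^sub>R x)) k) = k" for t g'
    proof -
      have "((\<lambda>t. t *\<^sub>R x) has_derivative (\<lambda>s. s *\<^sub>R x)) (at t within {0..1})"
        by (auto intro!: derivative_eq_intros)
      from has_derivative_compose[OF this conjunct1[OF euler[OF tV[OF that(1)] that(2,3)]]]
      show ?thesis .
    qed
    have ex: "\<exists>g'. (\<Psi> has_derivative g') (at (t *\<^sub>R x)) \<and> (\<forall>k. g' (fd \<Phi> (\<Psi> (t *\<^sub>R x)) k) = k)"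
      if "t \<in> {0..1}" for t
      using \<Psi>[OF tV[OF that]] by blast
    have "?f 1 = ?f 0"
    proof (rule has_derivative_zero_unique_strong_interval[where k = "{0}" and f = ?f and a = 0 and b = 1])
      show "continuous_on {0..1} ?f"
        unfolding continuous_on_eq_continuous_within
        using der ex has_derivative_continuous by blast
      fix t :: real assume t: "t \<in> {0..1} - {0}"
      then obtain g' where g': "(\<Psi> has_derivative g') (at (t *\<^sub>R x))" "\<And>k. g' (fd \<Phi> (\<Psi> (t *\<^sub>R x)) k) = k"
        using ex by blast
      have u: "\<Psi> (t *\<^sub>R x) \<in> D" using \<Psi>U(1)[OF tV] t U(2) by auto
      have lin: "linear (\<lambda>v. fd n (\<Psi> (t *\<^sub>R x)) (g' v))"
        using linear_compose[OF has_derivative_linear[OF g'(1)] fd_linear[OF n(1) u]] by (simp add: comp_def)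
      have "fd n (\<Psi> (t *\<^sub>R x)) (g' (t *\<^sub>R x)) = 0"
        using euler[OF tV g'] t by auto
      then have "t *\<^sub>R fd n (\<Psi> (t *\<^sub>R x)) (g' x) = 0" by (simp add: linear_cmul[OF lin])
      then have "fd n (\<Psi> (t *\<^sub>R x)) (g' (s *\<^sub>R x)) = 0" for s
        using t by (simp add: linear_cmul[OF lin])
      then show "(?f has_derivative (\<lambda>h. 0)) (at t within {0..1})"
        using der[OF _ g'] t by auto
    qed auto
    then show ?thesis by (simp add: 0(2))
  qed
  show ?thesis
  proof (rule that[of "\<Psi> ` ball 0 \<delta>"])
    have \<Psi>c: "continuous_on (ball 0 \<delta>) \<Psi>"
      using homeomorphism_cont2[OF hom] \<delta>(2) by (rule continuous_on_subset)
    have "inj_on \<Psi> (ball 0 \<delta>)"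
      using \<Psi>U(2) \<delta>(2) by (intro inj_on_inverseI[of _ \<Phi>]) blast
    then show "open (\<Psi> ` ball 0 \<delta>)"
      by (intro invariance_of_domain_gen \<Psi>c) auto
    show "connected (\<Psi> ` ball 0 \<delta>)" by (rule connected_continuous_image[OF \<Psi>c connected_ball])
    show "\<Psi> ` ball 0 \<delta> \<subseteq> D" using \<Psi>U(1) \<delta>(2) U(2) by blast
    show "u0 \<in> \<Psi> ` ball 0 \<delta>" using 0(2) \<delta>(1) by (intro image_eqI[of _ _ 0]) auto
    show "n u = n u0" if "u \<in> \<Psi> ` ball 0 \<delta>" for u using const that by auto
  qed
qed

lemma planar_vertex_if_nondegenerate:
  assumes "u0 \<in> D" "y u0 = 0" "inj (fd y u0)"
    and Y: "\<And>q. Y q = \<mu> *\<^sub>R (q - p0)"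
    and tan: "\<And>w. w \<in> tangent_space M (X u0) \<Longrightarrow> n u0 \<bullet> w = 0"
  shows "planar_vertex M Y (X u0)"
proof -
  obtain U where U: "open U" "U \<subseteq> D" "connected U" "u0 \<in> U" "\<And>u. u \<in> U \<Longrightarrow> n u = n u0"
    using normal_constant_near_vertex[OF assms(1-3)] by metis
  have "n u0 \<bullet> X u = n u0 \<bullet> X u0" if "u \<in> U" for u
  proof (rule has_derivative_zero_unique_connected[OF U(1,3) _ that U(4), of "\<lambda>u. n u0 \<bullet> X u"])
    fix v assume v: "v \<in> U"
    then have vD: "v \<in> D" using U(2) by blast
    have "((\<lambda>u. n u0 \<bullet> X u) has_derivative (\<lambda>a. n u0 \<bullet> fd X v a)) (at v)"
      by (rule has_derivative_inner_right[OF smooth_on_has_derivative[OF D(2) vD]])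
    then show "((\<lambda>u. n u0 \<bullet> X u) has_derivative (\<lambda>x. 0)) (at v)"
      using normal[OF vD] U(5)[OF v] by simp
  qed
  moreover have "openin (top_of_set M) (X ` U)"
    using local_parametrizationD(4)[OF local_parametrization_subset[OF chart U(1,2)]] .
  then obtain T where T: "open T" "X ` U = M \<inter> T" by (auto simp: openin_open)
  ultimately have "M \<inter> T \<subseteq> {x. n u0 \<bullet> x = n u0 \<bullet> X u0}" by (auto simp flip: T(2))
  moreover have "is_plane {x. n u0 \<bullet> x = n u0 \<bullet> X u0}"
    using nn[OF assms(1)] unfolding is_plane_def by (intro exI[of _ "n u0"]) auto
  moreover have "X u0 \<in> T" using T(2) U(4) by blast
  moreover have "Y (X u0) = (\<mu> * c) *\<^sub>R n u0"
    using assms(2) by (simp add: Y y_def)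
  ultimately show ?thesis
    unfolding planar_vertex_def using T(1) tan by auto
qed

text \<open>Where the tangential part \<open>y\<close> of \<open>Y\<close> vanishes and its derivative is degenerate, the Gauss map
  still has rank one. The rulings are then found as the kernels of its differential: \<open>e\<close> is orthogonal
  to \<open>n\<close> and to the image direction of \<open>dn\<close>. That \<open>e\<close> spans straight lines is inherited by continuity
  from the points with \<open>y u \<noteq> 0\<close>, which are dense.\<close>

lemma darboux_ruled_at_degenerate_point:
  assumes "u0 \<in> D" "y u0 = 0" "\<not> inj (fd y u0)"
    and dense: "\<And>Q. open Q \<Longrightarrow> Q \<subseteq> D \<Longrightarrow> Q \<noteq> {} \<Longrightarrow> \<exists>u\<in>Q. y u \<noteq> 0"
    and Y: "\<And>q. Y q = \<mu> *\<^sub>R (q - p0)"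
  shows "darboux_ruled_at M Y (X u0)"
proof -
  obtain w where w: "w \<noteq> 0" "fd y u0 w = 0"
    using assms(3) linear_injective_0[OF fd_linear[OF smooth_y assms(1)]] by blast
  then have "fd X u0 w = c *\<^sub>R fd n u0 w" by (simp add: fd_y[OF assms(1)])
  moreover have "fd X u0 w \<noteq> fd X u0 0" using D(3)[OF assms(1)] w(1) by (auto dest: injD)
  ultimately have nw: "fd n u0 w \<noteq> 0" using linear_0[OF fd_linear[OF D(2) assms(1)]] by auto
  define E where "E = {u \<in> D. fd n u w \<noteq> 0}"
  have "open (D \<inter> (\<lambda>u. fd n u w) -` (- {0}))"
    by (intro continuous_open_preimage smooth_on_continuous[OF smooth_on_fd[OF n(1)]] D(1)) auto
  moreover have "E = D \<inter> (\<lambda>u. fd n u w) -` (- {0})" by (auto simp: E_def)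
  ultimately have E: "open E" "E \<subseteq> D" "u0 \<in> E" using assms nw by (auto simp: E_def)
  interpret E: central_chart M X E n p0 c by (rule restrict_central[OF E(1,2)])
  define t where "t u = sgn (fd n u w)" for u
  define e where "e u = cross3 (n u) (t u)" for u
  define \<sigma> where "\<sigma> u = y u \<bullet> e u" for u
  have nw: "fd n u w \<noteq> 0" if "u \<in> E" for u using that by (simp add: E_def)
  have t: "norm (t u) = 1" "n u \<bullet> t u = 0" "y u \<bullet> t u = 0" if "u \<in> E" for u
    using nw[OF that] E.unit_field_fd[OF E.n that, of w] E.fd_n_y[OF that, of w]
    by (simp_all add: t_def norm_sgn, simp_all add: sgn_div_norm inner_commute)
  have smt: "smooth_on E t"
    unfolding t_def by (rule smooth_on_sgn[OF E(1) smooth_on_fd[OF E.n(1)] nw])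
  have e1: "smooth_on E e" unfolding e_def by (intro smooth_on_cross3 E.n(1) smt E(1))
  have e2: "norm (e u) = 1" if "u \<in> E" for u
    unfolding e_def by (rule frame_expansion(2)[OF E.n(2)[OF that] t(1,2)[OF that]])
  have e3: "n u \<bullet> e u = 0" for u by (simp add: e_def dot_cross_self)
  have expand: "x = (x \<bullet> t u) *\<^sub>R t u + (x \<bullet> e u) *\<^sub>R e u" if "u \<in> E" "n u \<bullet> x = 0" for u x
    using frame_expansion(1)[OF E.n(2)[OF that(1)] t(1,2)[OF that(1)], of x] that(2)
    by (simp add: e_def inner_commute)
  have \<sigma>1: "smooth_on E \<sigma>" unfolding \<sigma>_def by (intro smooth_on_inner E.smooth_y e1 E(1))
  have \<sigma>2: "y u = \<sigma> u *\<^sub>R e u" if "u \<in> E" for u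
    using expand[OF that E.n_y[OF that]] t(3)[OF that] by (simp add: \<sigma>_def)
  \<comment> \<open>An identity between continuous fields holds if it holds where \<open>y\<close> does not vanish.\<close>
  have by_density: "f u = 0" if f: "continuous_on E f" "\<And>u. u \<in> E \<Longrightarrow> y u \<noteq> 0 \<Longrightarrow> f u = 0" and "u \<in> E"
    for f :: "real \<times> real \<Rightarrow> 'z::real_normed_vector" and u
  proof (rule ccontr)
    assume "f u \<noteq> 0"
    have "open (E \<inter> f -` (- {0}))"
      by (intro continuous_open_preimage f E(1)) auto
    moreover have "E \<inter> f -` (- {0}) \<subseteq> D" "E \<inter> f -` (- {0}) \<noteq> {}"
      using E(2) \<open>f u \<noteq> 0\<close> \<open>u \<in> E\<close> by auto
    ultimately obtain u' where "u' \<in> E \<inter> f -` (- {0})" "y u' \<noteq> 0" using dense by blast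
    then show False using f(2)[of u'] by blast
  qed
  have en: "fd n u b \<bullet> e u = 0" if "u \<in> E" for u b
  proof (rule by_density[OF _ _ that])
    show "continuous_on E (\<lambda>u. fd n u b \<bullet> e u)"
      by (intro continuous_on_inner smooth_on_continuous[OF e1] smooth_on_continuous[OF smooth_on_fd[OF E.n(1)]])
    show "fd n u b \<bullet> e u = 0" if "u \<in> E" "y u \<noteq> 0" for u
      using E.fd_n_y[OF that(1), of b] \<sigma>2[OF that(1)] that(2) by (metis inner_scaleR_right mult_eq_0_iff scaleR_zero_left)
  qed
  have minors: "(fd X u a \<bullet> t u) *\<^sub>R fd e u b - (fd X u b \<bullet> t u) *\<^sub>R fd e u a = 0" if "u \<in> E" for u a b
  proof (rule by_density[OF _ _ that])
    show "continuous_on E (\<lambda>u. (fd X u a \<bullet> t u) *\<^sub>R fd e u b - (fd X u b \<bullet> t u) *\<^sub>R fd e u a)"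
      by (intro continuous_on_diff continuous_on_scaleR continuous_on_inner smooth_on_continuous[OF smt]
          smooth_on_continuous[OF smooth_on_fd[OF e1]] smooth_on_continuous[OF smooth_on_fd[OF E.D(2)]])
    fix u assume u: "u \<in> E" "y u \<noteq> 0"
    then have "\<sigma> u \<noteq> 0" using \<sigma>2[OF u(1)] by auto
    obtain W where W: "fd X u W = e u" using E.tangent_vector[OF u(1) e3] by blast
    have eW: "fd e u W = 0"
      by (rule E.ruling_field(2)[OF e1 e2 e3 en \<sigma>1 \<sigma>2 u(1) \<open>\<sigma> u \<noteq> 0\<close> W])
    note linX = fd_linear[OF E.D(2) u(1)] and line = fd_linear[OF e1 u(1)]
    define v where "v = (fd X u a \<bullet> t u) *\<^sub>R b - (fd X u b \<bullet> t u) *\<^sub>R a"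
    have Xv: "fd X u v = (fd X u a \<bullet> t u) *\<^sub>R fd X u b - (fd X u b \<bullet> t u) *\<^sub>R fd X u a"
      by (simp add: v_def linear_diff[OF linX] linear_cmul[OF linX])
    then have "fd X u v \<bullet> t u = 0" by (simp add: inner_diff_left)
    then have "fd X u v = (fd X u v \<bullet> e u) *\<^sub>R e u"
      using expand[OF u(1) E.normal[OF u(1)], of v] by simp
    also have "\<dots> = fd X u ((fd X u v \<bullet> e u) *\<^sub>R W)" by (simp add: linear_cmul[OF linX] W)
    finally have "v = (fd X u v \<bullet> e u) *\<^sub>R W" by (rule injD[OF E.D(3)[OF u(1)]])
    then have "fd e u v = fd e u ((fd X u v \<bullet> e u) *\<^sub>R W)" by (rule arg_cong)
    then have "fd e u v = 0" by (simp only: linear_cmul[OF line] eW scaleR_zero_right)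
    then show "(fd X u a \<bullet> t u) *\<^sub>R fd e u b - (fd X u b \<bullet> t u) *\<^sub>R fd e u a = 0"
      by (simp add: v_def linear_diff[OF line] linear_cmul[OF line])
  qed
  show ?thesis
  proof (rule E.darboux_ruled_at_if_field[OF E(3) e1 e2 e3 en \<sigma>1 \<sigma>2 _ _ Y])
    show "\<sigma> u0 \<ge> 0" using assms(2) by (simp add: \<sigma>_def)
    fix u W assume u: "u \<in> E" and W: "fd X u W = e u"
    obtain a where a: "fd X u a = t u" using E.tangent_vector[OF u t(2)[OF u]] by blast
    have "t u \<bullet> t u = 1" using t(1)[OF u] by (simp add: norm_eq_1)
    then show "fd e u W = 0"
      using minors[OF u, of a W] by (simp add: a W e_def dot_cross_self)
  qed
qed

end

text \<open>A constant axis. The tangential part of \<open>Y\<close> has constant length, and the base curve lies in the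
  plane orthogonal to \<open>Y\<close> through the given point.\<close>

lemma (in normal_chart) darboux_ruled_at_constant_axis:
  assumes "u0 \<in> D" "v \<noteq> 0" "\<And>q. Y q = v" "\<And>u. u \<in> D \<Longrightarrow> n u \<bullet> v = \<kappa>" "v \<noteq> \<kappa> *\<^sub>R n u0"
  shows "darboux_ruled_at M Y (X u0)"
proof -
  define \<rho> where "\<rho> = norm (v - \<kappa> *\<^sub>R n u0)"
  define e where "e u = (1 / \<rho>) *\<^sub>R (v - \<kappa> *\<^sub>R n u)" for u
  define s where "s u = (1 / \<rho>) * ((X u - X u0) \<bullet> v)" for u
  have \<rho>: "\<rho> > 0" using assms(5) by (simp add: \<rho>_def)
  have tang: "(v - \<kappa> *\<^sub>R n u) \<bullet> (v - \<kappa> *\<^sub>R n u) = v \<bullet> v - \<kappa> * \<kappa>" if "u \<in> D" for u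
    using assms(4)[OF that] nn[OF that] by (simp add: inner_diff_left inner_diff_right inner_commute)
  have \<rho>2: "\<rho> * \<rho> = v \<bullet> v - \<kappa> * \<kappa>"
    using tang[OF assms(1)] by (simp add: \<rho>_def dot_square_norm power2_eq_square)
  have e1: "smooth_on D e" unfolding e_def
    by (intro smooth_on_scaleR smooth_on_diff smooth_on_const n(1) D(1))
  have e2: "norm (e u) = 1" if "u \<in> D" for u
  proof -
    have "e u \<bullet> e u = (1 / (\<rho> * \<rho>)) * (v \<bullet> v - \<kappa> * \<kappa>)"
      by (simp add: e_def tang[OF that])
    then show ?thesis using \<rho> by (simp add: norm_eq_1 \<rho>2[symmetric])
  qed
  have ev: "e u \<bullet> v = \<rho>" if "u \<in> D" for u
  proof -
    have "e u \<bullet> v = (1 / \<rho>) * (v \<bullet> v - \<kappa> * \<kappa>)"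
      by (simp add: e_def inner_diff_left assms(4)[OF that])
    then show ?thesis using \<rho> by (simp add: \<rho>2[symmetric])
  qed
  have e3: "n u \<bullet> e u = 0" if "u \<in> D" for u
    using nn[OF that] assms(4)[OF that] by (simp add: e_def inner_diff_right)
  have fde: "fd e u a = (1 / \<rho>) *\<^sub>R (- (\<kappa> *\<^sub>R fd n u a))" if u: "u \<in> D" for u a
  proof -
    have sm: "smooth_on D (\<lambda>u. \<kappa> *\<^sub>R n u)" "smooth_on D (\<lambda>u. v - \<kappa> *\<^sub>R n u)"
      by (intro smooth_on_scaleR smooth_on_diff smooth_on_const n(1) D(1))+
    show ?thesis
      unfolding e_def
      by (simp add: fd_scaleR[OF smooth_on_const[OF D(1)] sm(2) u] fd_diff[OF smooth_on_const[OF D(1)] sm(1) u]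
          fd_scaleR[OF smooth_on_const[OF D(1)] n(1) u])
  qed
  have s1: "smooth_on D s" unfolding s_def
    by (intro smooth_on_mult smooth_on_inner smooth_on_diff smooth_on_const D(1,2))
  have fds: "fd s u a = fd X u a \<bullet> e u" if u: "u \<in> D" for u a
  proof -
    have sm: "smooth_on D (\<lambda>u. X u - X u0)" "smooth_on D (\<lambda>u. (X u - X u0) \<bullet> v)"
      by (intro smooth_on_inner smooth_on_diff smooth_on_const D(1,2))+
    have "fd s u a = (1 / \<rho>) * fd (\<lambda>u. (X u - X u0) \<bullet> v) u a + fd (\<lambda>u. 1 / \<rho>) u a * ((X u - X u0) \<bullet> v)"
      unfolding s_def by (rule fd_bilinear[OF bounded_bilinear_mult smooth_on_const[OF D(1)] sm(2) u])
    then have "fd s u a = (1 / \<rho>) * (fd X u a \<bullet> v)"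
      by (simp add: fd_inner_const[OF sm(1) u] fd_diff[OF D(2) smooth_on_const[OF D(1)] u])
    then show ?thesis
      using normal[OF u, of a] by (simp add: e_def inner_diff_right inner_commute)
  qed
  have ruling: "\<exists>W. fd X u W = e u \<and> fd e u W = 0" if u: "u \<in> D" for u
  proof -
    obtain W where W: "fd X u W = e u" using tangent_vector[OF u e3[OF u]] by blast
    have "fd n u W = 0"
    proof (rule shape_kernel[OF u])
      fix b
      have "n u \<bullet> fd (\<lambda>u. v) u b = - (fd n u b \<bullet> v)"
        by (rule orthogonal_fields_fd[OF n(1) smooth_on_const[OF D(1)] assms(4) u])
      then show "fd n u b \<bullet> fd X u W = 0"
        using unit_field_fd[OF n u, of b] unfolding W by (simp add: e_def inner_diff_right inner_commute)
    qed
    then have "fd e u W = 0" by (simp add: fde[OF u])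
    then show ?thesis using W by blast
  qed
  define \<phi> where "\<phi> = arcsin (\<rho> / norm v)"
  have v: "norm v > 0" using assms(2) by simp
  have "\<rho> \<le> norm v"
  proof (rule power2_le_imp_le)
    show "\<rho>\<^sup>2 \<le> (norm v)\<^sup>2" using \<rho>2 by (simp add: power2_eq_square power2_norm_eq_inner[symmetric] dot_square_norm)
  qed simp
  then have q: "0 < \<rho> / norm v" "\<rho> / norm v \<le> 1" using \<rho> v by auto
  have \<phi>: "sin \<phi> = \<rho> / norm v" "0 < \<phi>" "\<phi> \<le> pi / 2"
    using q arcsin_less_arcsin[of 0 "\<rho> / norm v"] arcsin_ubound[of "\<rho> / norm v"] unfolding \<phi>_def by simp_all
  have base: "X u - s u *\<^sub>R e u + 0 *\<^sub>R e u \<in> {x. v \<bullet> x = v \<bullet> X u0} \<and> e u \<bullet> sgn v = sin \<phi>" if u: "u \<in> D" for u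
  proof -
    have "v \<bullet> (X u - s u *\<^sub>R e u) = v \<bullet> X u - s u * \<rho>"
      using ev[OF u] by (simp add: inner_diff_right inner_commute)
    also have "s u * \<rho> = v \<bullet> X u - v \<bullet> X u0"
      using \<rho> by (simp add: s_def inner_diff_left inner_diff_right inner_commute)
    finally show ?thesis using ev[OF u] \<phi>(1) by (simp add: sgn_div_norm divide_inverse mult.commute)
  qed
  show ?thesis
  proof (rule darboux_ruled_if_ruling_field[OF chart assms(1) e1 e2 s1 _ fds ruling])
    show "s u0 = 0" by (simp add: s_def)
    show "\<exists>z1 S \<eta> \<phi>. \<bar>z1\<bar> < \<epsilon> \<and> 0 < \<phi> \<and> \<phi> \<le> pi / 2 \<and> umbilical_support S \<eta> Y \<and>
      (\<forall>u\<in>D. X u - s u *\<^sub>R e u + z1 *\<^sub>R e u \<in> S \<and> e u \<bullet> \<eta> (X u - s u *\<^sub>R e u + z1 *\<^sub>R e u) = sin \<phi>)"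
      if "\<epsilon> > 0" for \<epsilon>
      using that \<phi>(2,3) base umbilical_support_plane[of v Y "v \<bullet> X u0", OF assms(2,3)]
      by (intro exI[of _ 0] exI[of _ "{x. v \<bullet> x = v \<bullet> X u0}"] exI[of _ "\<lambda>x. sgn v"] exI[of _ \<phi>]) simp
  qed
qed

section \<open>Global degeneracy\<close>

lemma ex_normal_chart:
  assumes "regular_surface M" "unit_normal_field M N" "p \<in> M"
  obtains X D u0 where "normal_chart M X D (\<lambda>u. N (X u))" "u0 \<in> D" "X u0 = p" "connected D"
proof -
  obtain X D where X: "local_parametrization M X D" "p \<in> X ` D"
    using assms(1,3) by (auto simp: regular_surface_def)
  then obtain u0 where u0: "u0 \<in> D" "X u0 = p" by auto
  obtain r where r: "r > 0" "ball u0 r \<subseteq> D" "smooth_on (ball u0 r) (\<lambda>u. N (X u))"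
    using unit_normal_smooth_in_chart[OF X(1) assms(2) u0(1)] by metis
  have X': "local_parametrization M X (ball u0 r)"
    by (rule local_parametrization_subset[OF X(1) open_ball r(2)])
  have "normal_chart M X (ball u0 r) (\<lambda>u. N (X u))"
  proof
    show "norm (N (X u)) = 1" "N (X u) \<bullet> fd X u a = 0" if "u \<in> ball u0 r" for u a
      using assms(2) fd_in_tangent_space[OF X' that] local_parametrizationD(5)[OF X'] that
      unfolding unit_normal_field_def by blast+
  qed (rule X' r(3))+
  then show ?thesis using that[of X "ball u0 r" u0] u0(2) r(1) by simp
qed

lemma constant_on_surface_if_locally_constant:
  fixes f :: "real^3 \<Rightarrow> 'a"
  assumes "connected M" "\<And>p. p \<in> M \<Longrightarrow> \<exists>T. openin (top_of_set M) T \<and> p \<in> T \<and> (\<forall>x\<in>T. f x = f p)"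
    "p \<in> M" "q \<in> M"
  shows "f p = f q"
proof (rule connected_local_const[OF assms(1,3,4)], intro ballI)
  fix a assume "a \<in> M"
  then obtain T where T: "openin (top_of_set M) T" "a \<in> T" "\<forall>x\<in>T. f x = f a" using assms(2)[of a] by blast
  then obtain Q where Q: "open Q" "T = M \<inter> Q" by (auto simp: openin_open)
  have "f a = f b" if "b \<in> Q" "b \<in> M" for b
    using T(3) Q(2) that by (metis IntI)
  then show "\<forall>\<^sub>F b in at a within M. f a = f b"
    unfolding eventually_at_topological using T(2) Q by blast
qed

text \<open>If a constant axis is normal to \<open>M\<close> everywhere, its height function is locally constant.\<close>

lemma constant_normal_imp_planar:
  assumes "regular_surface M" "connected M" "unit_normal_field M N" "v \<noteq> 0"
    "\<And>x. x \<in> M \<Longrightarrow> v = \<kappa> *\<^sub>R N x" "M \<noteq> {}"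
  shows "\<exists>P. is_plane P \<and> openin (top_of_set P) M"
proof -
  obtain p where p: "p \<in> M" using assms(6) by blast
  have "v \<bullet> x = v \<bullet> p" if x: "x \<in> M" for x
  proof (rule constant_on_surface_if_locally_constant[OF assms(2) _ x p])
    fix q assume "q \<in> M"
    then obtain X D u0 where *: "normal_chart M X D (\<lambda>u. N (X u))" "u0 \<in> D" "X u0 = q" "connected D"
      using ex_normal_chart[OF assms(1,3)] by metis
    interpret normal_chart M X D "\<lambda>u. N (X u)" by fact
    have "v \<bullet> X u = v \<bullet> X u0" if "u \<in> D" for u
    proof (rule has_derivative_zero_unique_connected[OF D(1) *(4) _ that *(2), of "\<lambda>u. v \<bullet> X u"])
      fix w assume w: "w \<in> D"
      have "((\<lambda>u. v \<bullet> X u) has_derivative (\<lambda>a. v \<bullet> fd X w a)) (at w)"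
        by (rule has_derivative_inner_right[OF smooth_on_has_derivative[OF D(2) w]])
      moreover have "v \<bullet> fd X w a = 0" for a
        using assms(5)[of "X w"] normal[OF w, of a] D(5) w by (metis image_subset_iff inner_scaleR_left mult_zero_right)
      ultimately show "((\<lambda>u. v \<bullet> X u) has_derivative (\<lambda>x. 0)) (at w)" by simp
    qed
    then show "\<exists>T. openin (top_of_set M) T \<and> q \<in> T \<and> (\<forall>x\<in>T. v \<bullet> x = v \<bullet> q)"
      using D(4) *(2,3) by (intro exI[of _ "X ` D"]) auto
  qed
  then have "M \<subseteq> {x. v \<bullet> x = v \<bullet> p}" by blast
  then have "openin (top_of_set {x. v \<bullet> x = v \<bullet> p}) M"
    by (rule openin_plane_if_regular[OF assms(1,4)])
  then show ?thesis using assms(4) unfolding is_plane_def by blast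
qed

text \<open>An open piece of \<open>M\<close> where \<open>Y\<close> is normal is spherical and has Gauss curvature \<open>1 / c\<^sup>2\<close>, whereas
  the curvature vanishes where \<open>Y\<close> is not normal. Since the curvature is continuous, a boundary
  point of such a piece cannot exist. Below, the curvature is represented by the cross product of the
  two partial derivatives of the unit normal.\<close>

lemma spherical_if_locally_spherical:
  assumes M: "regular_surface M" "connected M" "unit_normal_field M N"
    and support: "\<And>x. x \<in> M \<Longrightarrow> N x \<bullet> (x - p0) = c" and "c \<noteq> 0"
    and Q: "openin (top_of_set M) Q" "Q \<noteq> {}" "\<And>x. x \<in> Q \<Longrightarrow> x - p0 = c *\<^sub>R N x" and "x \<in> M"
  shows "x - p0 = c *\<^sub>R N x"
proof -
  define W where "W = \<Union>{T. openin (top_of_set M) T \<and> (\<forall>x\<in>T. x - p0 = c *\<^sub>R N x)}"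
  have W_open: "openin (top_of_set M) W" unfolding W_def by (intro openin_Union) blast
  have W: "x - p0 = c *\<^sub>R N x" if "x \<in> W" for x using that by (auto simp: W_def)
  have W_max: "T \<subseteq> W" if "openin (top_of_set M) T" "\<And>x. x \<in> T \<Longrightarrow> x - p0 = c *\<^sub>R N x" for T
    using that unfolding W_def by blast
  have "(x \<in> W) = (q \<in> W)" if "q \<in> Q" for q
  proof (rule constant_on_surface_if_locally_constant[OF M(2) _ \<open>x \<in> M\<close>])
    show "q \<in> M" using that openin_imp_subset[OF Q(1)] by blast
    fix p assume "p \<in> M"
    then obtain X D u0 where *: "normal_chart M X D (\<lambda>u. N (X u))" "u0 \<in> D" "X u0 = p" "connected D"
      using ex_normal_chart[OF M(1,3)] by metis
    let ?n = "\<lambda>u. N (X u)"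
    interpret normal_chart M X D ?n by fact
    have XM: "X u \<in> M" if "u \<in> D" for u using D(5) that by blast
    interpret central_chart M X D ?n p0 c by unfold_locales (rule support[OF XM])
    define K where "K u = cross3 (fd ?n u (1,0)) (fd ?n u (0,1))" for u
    define A where "A u = (1 / c\<^sup>2) *\<^sub>R cross3 (fd X u (1,0)) (fd X u (0,1))" for u
    have contK: "continuous_on D K" unfolding K_def
      by (intro smooth_on_continuous smooth_on_cross3 smooth_on_fd n(1) D(1))
    have contA: "continuous_on D A" unfolding A_def
      by (intro smooth_on_continuous smooth_on_scaleR smooth_on_const smooth_on_cross3 smooth_on_fd D(1,2))
    have curved: "K u = A u" if u: "u \<in> D" "X u \<in> W" for u
    proof -
      obtain T where T: "open T" "W = M \<inter> T" using W_open by (auto simp: openin_open)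
      have "open (D \<inter> X -` T)" by (intro continuous_open_preimage D(6,1) T(1))
      moreover have "u \<in> D \<inter> X -` T" using u T(2) by blast
      moreover have "y v = 0" if "v \<in> D \<inter> X -` T" for v
        using W[of "X v"] T(2) XM that by (simp add: y_def)
      ultimately have "fd y u a = fd (\<lambda>v. 0) u a" for a
        by (intro fun_cong[OF fd_cong_open])
      then have "fd X u a = c *\<^sub>R fd ?n u a" for a by (simp add: fd_y[OF u(1)])
      then show ?thesis
        using \<open>c \<noteq> 0\<close> by (simp add: K_def A_def cross_mult_left cross_mult_right power2_eq_square)
    qed
    have flat: "K u = 0" if u: "u \<in> D" "y u \<noteq> 0" for u
    proof -
      obtain V where V: "fd X u V = y u" using tangent_vector[OF u(1) n_y[OF u(1)]] by blast
      have lin: "linear (fd ?n u)" by (rule fd_linear[OF n(1) u(1)])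
      have nV: "fd ?n u V = 0" by (rule shape_y[OF u(1) V])
      have V0: "V \<noteq> 0" using V u(2) linear_0[OF fd_linear[OF D(2) u(1)]] by auto
      have ex: "fd ?n u V = fst V *\<^sub>R fd ?n u (1,0) + snd V *\<^sub>R fd ?n u (0,1)"
      proof -
        have "fd ?n u (fst V *\<^sub>R (1,0) + snd V *\<^sub>R (0,1)) = fst V *\<^sub>R fd ?n u (1,0) + snd V *\<^sub>R fd ?n u (0,1)"
          by (simp only: linear_add[OF lin] linear_cmul[OF lin])
        then show ?thesis by simp
      qed
      have z: "fst V *\<^sub>R fd ?n u (1,0) + snd V *\<^sub>R fd ?n u (0,1) = 0"
        using ex nV by simp
      have "fst V *\<^sub>R K u = 0"
        using arg_cong[OF z, of "\<lambda>x. cross3 x (fd ?n u (0,1))"]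
        by (simp add: K_def cross_add_left cross_mult_left)
      moreover have "snd V *\<^sub>R K u = 0"
        using arg_cong[OF z, of "cross3 (fd ?n u (1,0))"]
        by (simp add: K_def cross_add_right cross_mult_right)
      ultimately show ?thesis using V0 by (auto simp: prod_eq_iff)
    qed
    have img: "openin (top_of_set M) (X ` E)" if "open E" "E \<subseteq> D" for E
      by (rule local_parametrizationD(4)[OF local_parametrization_subset[OF chart that]])
    show "\<exists>T. openin (top_of_set M) T \<and> p \<in> T \<and> (\<forall>x\<in>T. (x \<in> W) = (p \<in> W))"
    proof (cases "K u0 = A u0")
      case True
      \<comment> \<open>The curvature is nonzero near \<open>u0\<close>, so \<open>Y\<close> is normal there.\<close>
      have "A u0 \<noteq> 0"
        using cross3_nonzero_if_inj[OF fd_linear[OF D(2) *(2)] D(3)[OF *(2)]] \<open>c \<noteq> 0\<close> by (simp add: A_def)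
      define E where "E = D \<inter> K -` (- {0})"
      have "open E" unfolding E_def by (intro continuous_open_preimage contK D(1)) auto
      moreover have "u0 \<in> E" using *(2) True \<open>A u0 \<noteq> 0\<close> by (simp add: E_def)
      moreover have E: "E \<subseteq> D" by (auto simp: E_def)
      moreover have "X ` E \<subseteq> W"
      proof (rule W_max[OF img[OF \<open>open E\<close> E]])
        fix x assume "x \<in> X ` E"
        then obtain u where u: "u \<in> D" "K u \<noteq> 0" "x = X u" by (auto simp: E_def)
        then have "y u = 0" using flat by blast
        then show "x - p0 = c *\<^sub>R N x" using u(3) by (simp add: y_def)
      qed
      ultimately show ?thesis
        using img[OF \<open>open E\<close> E] *(3) by (intro exI[of _ "X ` E"]) blast
    next
      case False
      \<comment> \<open>The curvature differs from \<open>1 / c\<^sup>2\<close> near \<open>u0\<close>, so no spherical piece comes close.\<close>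
      define E where "E = D \<inter> (\<lambda>u. K u - A u) -` (- {0})"
      have "open E" unfolding E_def
        by (intro continuous_open_preimage continuous_on_diff contK contA D(1)) auto
      moreover have "u0 \<in> E" using *(2) False by (simp add: E_def)
      moreover have E: "E \<subseteq> D" by (auto simp: E_def)
      moreover have "X u \<notin> W" if "u \<in> E" for u using curved[of u] that by (auto simp: E_def)
      ultimately show ?thesis
        using img[OF \<open>open E\<close> E] *(3) by (intro exI[of _ "X ` E"]) blast
    qed
  qed
  moreover have "Q \<subseteq> W" by (rule W_max[OF Q(1,3)])
  ultimately have "x \<in> W" using Q(2) by blast
  then show ?thesis by (rule W)
qed

section \<open>Local parametrization of concircular surfaces\<close>

theorem theorem3p6:
  fixes M :: "(real^3) set" and Y :: "real^3 \<Rightarrow> real^3"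
  assumes "concircular_surface M Y"
    and "\<exists>q. Y q \<noteq> 0"
    and "nontrivial_surface M"
  shows "\<forall>p\<in>M. \<not> planar_vertex M Y p \<longrightarrow>
    (\<exists>\<phi> S \<eta> I J \<beta> T B.
       0 < \<phi> \<and> \<phi> \<le> pi / 2 \<and>
       totally_umbilical S \<and> unit_normal_field S \<eta> \<and> (\<forall>q\<in>S. \<exists>k. Y q = k *\<^sub>R \<eta> q) \<and>
       open I \<and> is_interval I \<and> open J \<and> is_interval J \<and> 0 \<in> J \<and>
       smooth_on I \<beta> \<and> darboux_frame S \<eta> I \<beta> T B \<and>
       (let X = (\<lambda>(t, z). \<beta> t + z *\<^sub>R (cos \<phi> *\<^sub>R B t + sin \<phi> *\<^sub>R \<eta> (\<beta> t)))
        in local_parametrization M X (I \<times> J) \<and> p \<in> X ` (I \<times> J)))"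
  unfolding darboux_ruled_at_def[symmetric]
proof (intro ballI impI)
  fix p assume p: "p \<in> M" "\<not> planar_vertex M Y p"
  obtain N where M: "regular_surface M" "connected M" and N: "unit_normal_field M N"
    and NY: "(\<lambda>p. N p \<bullet> Y p) constant_on M" and "concircular_field Y"
    using assms(1) by (auto simp: concircular_surface_def)
  then obtain \<mu> v where Y: "\<And>q. Y q = \<mu> *\<^sub>R q + v" by (auto simp: concircular_field_def)
  obtain \<kappa> where \<kappa>: "\<And>x. x \<in> M \<Longrightarrow> N x \<bullet> Y x = \<kappa>" using NY by (auto simp: constant_on_def)
  have N1: "N x \<bullet> N x = 1" if "x \<in> M" for x
    using N that by (simp add: unit_normal_field_def norm_eq_1)
  obtain X D u0 where *: "normal_chart M X D (\<lambda>u. N (X u))" "u0 \<in> D" "X u0 = p" "connected D"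
    using ex_normal_chart[OF M(1) N p(1)] by metis
  interpret normal_chart M X D "\<lambda>u. N (X u)" by fact
  have XM: "X u \<in> M" if "u \<in> D" for u using D(5) that by blast
  show "darboux_ruled_at M Y p"
  proof (cases "\<mu> = 0")
    case True
    then have Yv: "Y q = v" for q using Y by simp
    then have v: "v \<noteq> 0" using assms(2) by auto
    have "v \<noteq> \<kappa> *\<^sub>R N p"
    proof
      assume eq: "v = \<kappa> *\<^sub>R N p"
      then have vv: "v \<bullet> v = \<kappa> * \<kappa>" using N1[OF p(1)] by simp
      have "v = \<kappa> *\<^sub>R N x" if x: "x \<in> M" for x
      proof -
        have "(v - \<kappa> *\<^sub>R N x) \<bullet> (v - \<kappa> *\<^sub>R N x) = 0"
          using \<kappa>[OF x] N1[OF x] vv by (simp add: Yv inner_diff_left inner_diff_right inner_commute)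
        then show ?thesis by simp
      qed
      then show False
        using constant_normal_imp_planar[OF M N v, of \<kappa>] assms(3) p(1) by (auto simp: nontrivial_surface_def)
    qed
    moreover have "N (X u) \<bullet> v = \<kappa>" if "u \<in> D" for u
      using \<kappa>[OF XM[OF that]] by (simp only: Yv)
    ultimately show ?thesis
      using darboux_ruled_at_constant_axis[where Y = Y, OF *(2) v Yv] *(3) by blast
  next
    case False
    define p0 where "p0 = - ((1 / \<mu>) *\<^sub>R v)"
    define c where "c = \<kappa> / \<mu>"
    have Y': "Y q = \<mu> *\<^sub>R (q - p0)" for q
      using False by (simp add: Y p0_def scaleR_add_right)
    have c: "N x \<bullet> (x - p0) = c" if "x \<in> M" for x
      using \<kappa>[OF that] False by (simp add: Y' c_def nonzero_eq_divide_eq mult.commute)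
    interpret central_chart M X D "\<lambda>u. N (X u)" p0 c by unfold_locales (rule c[OF XM])
    show ?thesis
    proof (cases "y u0 = 0")
      case False
      then show ?thesis using darboux_ruled_at_regular_point[OF *(2) _ Y'] *(3) by simp
    next
      case y0: True
      have "\<not> inj (fd y u0)"
        using planar_vertex_if_nondegenerate[OF *(2) y0 _ Y'] N p *(3)
        by (auto simp: unit_normal_field_def)
      moreover have "\<exists>u\<in>Q. y u \<noteq> 0" if Q: "open Q" "Q \<subseteq> D" "Q \<noteq> {}" and "c \<noteq> 0" for Q
      proof (rule ccontr)
        assume "\<not> ?thesis"
        then have "x - p0 = c *\<^sub>R N x" if "x \<in> X ` Q" for x using that by (auto simp: y_def)
        moreover have "openin (top_of_set M) (X ` Q)"
          by (rule local_parametrizationD(4)[OF local_parametrization_subset[OF chart Q(1,2)]])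
        ultimately have sph: "x - p0 = c *\<^sub>R N x" if "x \<in> M" for x
          using spherical_if_locally_spherical[OF M N c \<open>c \<noteq> 0\<close> _ _ _ that, of "X ` Q"] Q(3) by blast
        have "M \<subseteq> sphere p0 \<bar>c\<bar>"
        proof
          fix x assume x: "x \<in> M"
          have "norm (x - p0) = \<bar>c\<bar>"
            using N x by (simp add: sph[OF x] unit_normal_field_def)
          then show "x \<in> sphere p0 \<bar>c\<bar>" by (simp add: dist_norm norm_minus_commute)
        qed
        then have "openin (top_of_set (sphere p0 \<bar>c\<bar>)) M"
          using openin_sphere_if_regular[OF M(1)] \<open>c \<noteq> 0\<close> by simp
        moreover have "is_sphere (sphere p0 \<bar>c\<bar>)" using \<open>c \<noteq> 0\<close> unfolding is_sphere_def by (intro exI[of _ p0] exI[of _ "\<bar>c\<bar>"]) simp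
        ultimately show False using assms(3) unfolding nontrivial_surface_def by blast
      qed
      moreover have "c \<noteq> 0"
      proof
        assume "c = 0"
        have "fd y u0 = (\<lambda>a. fd X u0 a - c *\<^sub>R fd (\<lambda>u. N (X u)) u0 a)"
          by (rule ext) (rule fd_y[OF *(2)])
        also have "\<dots> = fd X u0" using \<open>c = 0\<close> by simp
        finally show False using D(3)[OF *(2)] \<open>\<not> inj (fd y u0)\<close> by simp
      qed
      ultimately show ?thesis
        using darboux_ruled_at_degenerate_point[OF *(2) y0 _ _ Y'] *(3) by blast
    qed
  qed
qed

end
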